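(* Let $\mathcal L$ be a factorial and almost prolongable language over a finite alphabet $\mathcal A$ whose complexity function $p(n)$ is unbounded. The following are equivalent: (1) $p$ grows subexponentially and the Benjamini–Schramm limit of the Rauzy graphs $R(n)$ exists; (2) the Rauzy graphs $R(n)$ converge to the line $\mathbf Z$; (3) $p$ grows subexponentially and the empirical spectral measures $\mu_{R(n)}$ converge weakly; (4) the empirical spectral measures $\mu_{R(n)}$ converge weakly to the probability measure with density $\frac{1}{\pi\sqrt{4-x^2}}$ with respect to Lebesgue measure on $[-2,2]$; (5) $\lim_{n\to\infty}\frac{p(n+1)}{p(n)}=1$; (6) $p$ grows subexponentially and the Benjamini–Schramm limit of the Rauzy digraphs $\vec R(n)$ exists; (7) the Rauzy digraphs $\vec R(n)$ converge to the directed line $\vec{\mathbf Z}$.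
   Context: Let $\mathcal A$ be a finite alphabet with $k=|\mathcal A|\ge 2$ letters and $\mathcal A^*$ the set of finite words over $\mathcal A$. A language is a subset $\mathcal L\subseteq\mathcal A^*$; write $\mathcal L_n=\mathcal L\cap\mathcal A^n$ and $p(n)=|\mathcal L_n|$ (the complexity function). $\mathcal L$ is factorial if every subword (contiguous block) of a word of $\mathcal L$ lies in $\mathcal L$. A word $v\in\mathcal L$ is left-prolongable (resp. right-prolongable) if $av\in\mathcal L$ (resp. $va\in\mathcal L$) for some $a\in\mathcal A$; $\mathcal L$ is prolongable if every word is both left- and right-prolongable, and almost prolongable if the proportion of left-prolongable words in $\mathcal L_n$ and the proportion of right-prolongable words in $\mathcal L_n$ both tend to $1$ as $n\to\infty$. $p$ grows subexponentially if $\lim_n \frac1n\log p(n)=0$. For $n\ge1$, the Rauzy digraph $\vec R(n)$ has vertex set $\mathcal L_n$ and, for each word $aub\in\mathcal L_{n+1}$ ($a,b\in\mathcal A$, $u\in\mathcal A^{n-1}$) with $au,ub\in\mathcal L_n$, one arc from $au$ to $ub$ (loops and multiple arcs allowed). The Rauzy graph $R(n)$ is obtained by forgetting orientations. Benjamini–Schramm convergence: for a finite (di)graph $G$, let $\nu_G$ be the law of the isomorphism class of the rooted connected component $(G_v,v)$ of a uniformly random vertex $v$, in the compact space of (isomorphism classes of) rooted connected (di)graphs of bounded degree with the local topology; $(G_n)$ has Benjamini–Schramm limit $\nu$ if $\nu_{G_n}\to\nu$ weakly. Convergence to $\mathbf Z$ (resp. $\vec{\mathbf Z}$) means the limit is the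 Dirac mass at the bi-infinite path (resp. bi-infinite directed path with arcs $i\to i+1$); equivalently, for each $r$ the proportion of vertices whose ball of radius $r$ is isomorphic to the ball of radius $r$ in $\mathbf Z$ (resp. $\vec{\mathbf Z}$) tends to $1$. The empirical spectral measure of a finite graph $G$ with adjacency matrix $A_G$ (entry $(u,v)$ = number of edges between $u$ and $v$, diagonal entries counting loops) is $\mu_G=\frac{1}{|V(G)|}\sum_{\lambda}m_\lambda\delta_\lambda$, the sum over eigenvalues $\lambda$ of $A_G$ with multiplicities $m_\lambda$. *)

theory Defs
  imports "HOL-Probability.Probability" "Jordan_Normal_Form.Char_Poly"
begin

definition factorial_lang :: "'a list set \<Rightarrow> bool" where
  "factorial_lang L \<longleftrightarrow> (\<forall>w\<in>L. \<forall>u x v. w = u @ x @ v \<longrightarrow> x \<in> L)"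

definition lang_n :: "'a list set \<Rightarrow> nat \<Rightarrow> 'a list set" where
  "lang_n L n = {w \<in> L. length w = n}"

definition complexity :: "'a list set \<Rightarrow> nat \<Rightarrow> nat" where
  "complexity L n = card (lang_n L n)"

definition left_prolongable :: "'a list set \<Rightarrow> 'a list \<Rightarrow> bool" where
  "left_prolongable L v \<longleftrightarrow> (\<exists>a. a # v \<in> L)"

definition right_prolongable :: "'a list set \<Rightarrow> 'a list \<Rightarrow> bool" where
  "right_prolongable L v \<longleftrightarrow> (\<exists>a. v @ [a] \<in> L)"

definition almost_prolongable :: "'a list set \<Rightarrow> bool" where
  "almost_prolongable L \<longleftrightarrow>
     (\<lambda>n. real (card {v \<in> lang_n L n. left_prolongable L v}) / real (complexity L n))
        \<longlonglongrightarrow> 1 \<and>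
     (\<lambda>n. real (card {v \<in> lang_n L n. right_prolongable L v}) / real (complexity L n))
        \<longlonglongrightarrow> 1"

definition subexponential :: "(nat \<Rightarrow> nat) \<Rightarrow> bool" where
  "subexponential p \<longleftrightarrow> (\<lambda>n. ln (real (p n)) / real n) \<longlonglongrightarrow> 0"

text \<open>Vertices of the Rauzy (di)graph of order n: the words of length n.
  Arcs: words w = aub of length n+1 in L with au, ub in L; the arc w goes
  from its tail butlast w = au to its head tl w = ub.  The undirected Rauzy
  graph has the same vertices and edges, with orientation forgotten.\<close>

definition rauzy_verts :: "'a list set \<Rightarrow> nat \<Rightarrow> 'a list set" where
  "rauzy_verts L n = lang_n L n"

definition rauzy_arcs :: "'a list set \<Rightarrow> nat \<Rightarrow> 'a list set" where
  "rauzy_arcs L n = {w \<in> lang_n L (n + 1). butlast w \<in> lang_n L n \<and> tl w \<in> lang_n L n}"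

definition rauzy_tail :: "'a list \<Rightarrow> 'a list" where
  "rauzy_tail w = butlast w"

definition rauzy_head :: "'a list \<Rightarrow> 'a list" where
  "rauzy_head w = tl w"

text \<open>A (di)graph is given by a vertex set V, an edge set E and tail/head maps
  (loops and multiple edges allowed).  Distances are taken in the underlying
  undirected graph.\<close>

definition adjacent :: "'e set \<Rightarrow> ('e \<Rightarrow> 'v) \<Rightarrow> ('e \<Rightarrow> 'v) \<Rightarrow> 'v \<Rightarrow> 'v \<Rightarrow> bool" where
  "adjacent E t h x y \<longleftrightarrow> (\<exists>e\<in>E. (t e = x \<and> h e = y) \<or> (t e = y \<and> h e = x))"

fun ball_verts :: "'v set \<Rightarrow> 'e set \<Rightarrow> ('e \<Rightarrow> 'v) \<Rightarrow> ('e \<Rightarrow> 'v) \<Rightarrow> 'v \<Rightarrow> nat \<Rightarrow> 'v set" where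
  "ball_verts V E t h v 0 = {v}"
| "ball_verts V E t h v (Suc r) =
     ball_verts V E t h v r \<union> {y \<in> V. \<exists>x\<in>ball_verts V E t h v r. adjacent E t h x y}"

definition ball_edges :: "'v set \<Rightarrow> 'e set \<Rightarrow> ('e \<Rightarrow> 'v) \<Rightarrow> ('e \<Rightarrow> 'v) \<Rightarrow> 'v \<Rightarrow> nat \<Rightarrow> 'e set" where
  "ball_edges V E t h v r = {e \<in> E. t e \<in> ball_verts V E t h v r \<and> h e \<in> ball_verts V E t h v r}"

definition rooted_iso_dir ::
  "'v set \<Rightarrow> 'e set \<Rightarrow> ('e \<Rightarrow> 'v) \<Rightarrow> ('e \<Rightarrow> 'v) \<Rightarrow> 'v \<Rightarrow>
   'w set \<Rightarrow> 'f set \<Rightarrow> ('f \<Rightarrow> 'w) \<Rightarrow> ('f \<Rightarrow> 'w) \<Rightarrow> 'w \<Rightarrow> bool" where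
  "rooted_iso_dir V E t h r0 V' E' t' h' r0' \<longleftrightarrow>
     (\<exists>f g. bij_betw f V V' \<and> bij_betw g E E' \<and> f r0 = r0' \<and>
        (\<forall>e\<in>E. f (t e) = t' (g e) \<and> f (h e) = h' (g e)))"

definition rooted_iso_undir ::
  "'v set \<Rightarrow> 'e set \<Rightarrow> ('e \<Rightarrow> 'v) \<Rightarrow> ('e \<Rightarrow> 'v) \<Rightarrow> 'v \<Rightarrow>
   'w set \<Rightarrow> 'f set \<Rightarrow> ('f \<Rightarrow> 'w) \<Rightarrow> ('f \<Rightarrow> 'w) \<Rightarrow> 'w \<Rightarrow> bool" where
  "rooted_iso_undir V E t h r0 V' E' t' h' r0' \<longleftrightarrow>
     (\<exists>f g. bij_betw f V V' \<and> bij_betw g E E' \<and> f r0 = r0' \<and>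
        (\<forall>e\<in>E. {f (t e), f (h e)} = {t' (g e), h' (g e)}))"

definition ball_freq ::
  "bool \<Rightarrow> 'a list set \<Rightarrow> nat \<Rightarrow> nat \<Rightarrow>
   'w set \<Rightarrow> 'f set \<Rightarrow> ('f \<Rightarrow> 'w) \<Rightarrow> ('f \<Rightarrow> 'w) \<Rightarrow> 'w \<Rightarrow> real" where
  "ball_freq d L n r VH EH tH hH oH =
     (let V = rauzy_verts L n; E = rauzy_arcs L n;
          iso = (if d then rooted_iso_dir else rooted_iso_undir)
      in real (card {v \<in> V. iso (ball_verts V E rauzy_tail rauzy_head v r)
                                 (ball_edges V E rauzy_tail rauzy_head v r)
                                 rauzy_tail rauzy_head v VH EH tH hH oH})
         / real (card V))"

text \<open>Benjamini--Schramm limit exists: for each radius r and each finite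
  rooted (di)graph H (any finite graph is isomorphic to one with vertices and
  edges labelled by naturals), the frequency of vertices whose r-ball is
  isomorphic to H converges.  (The Rauzy graphs have degree bounded by 2k.)\<close>
definition BS_limit_exists :: "bool \<Rightarrow> 'a list set \<Rightarrow> bool" where
  "BS_limit_exists d L \<longleftrightarrow>
     (\<forall>r (VH :: nat set) (EH :: nat set) tH hH oH.
        finite VH \<longrightarrow> finite EH \<longrightarrow>
        convergent (\<lambda>n. ball_freq d L n r VH EH tH hH oH))"

text \<open>Convergence to Z (d = False) / to the directed line (d = True): the
  proportion of vertices whose r-ball is isomorphic to the r-ball of Z, i.e.
  the path on {-r..r} with edges i -- i+1 (oriented i \<rightarrow> i+1), tends to 1.\<close>
definition BS_converges_to_line :: "bool \<Rightarrow> 'a list set \<Rightarrow> bool" where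
  "BS_converges_to_line d L \<longleftrightarrow>
     (\<forall>r. (\<lambda>n. ball_freq d L n r {-int r..int r} {-int r..<int r} (\<lambda>i. i) (\<lambda>i. i + 1) 0)
            \<longlonglongrightarrow> 1)"

text \<open>Adjacency matrix entry of the undirected Rauzy graph: number of edges
  between u and v (for u = v, the number of loops at u).\<close>
definition rauzy_adj :: "'a list set \<Rightarrow> nat \<Rightarrow> 'a list \<Rightarrow> 'a list \<Rightarrow> nat" where
  "rauzy_adj L n u v = card {w \<in> rauzy_arcs L n.
      (rauzy_tail w = u \<and> rauzy_head w = v) \<or> (rauzy_tail w = v \<and> rauzy_head w = u)}"

definition rauzy_enum :: "'a list set \<Rightarrow> nat \<Rightarrow> 'a list list" where
  "rauzy_enum L n = (SOME vs. distinct vs \<and> set vs = rauzy_verts L n)"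

definition rauzy_adj_matrix :: "'a list set \<Rightarrow> nat \<Rightarrow> real mat" where
  "rauzy_adj_matrix L n =
     (let vs = rauzy_enum L n
      in mat (length vs) (length vs) (\<lambda>(i, j). real (rauzy_adj L n (vs ! i) (vs ! j))))"

definition spectral_measure :: "'a list set \<Rightarrow> nat \<Rightarrow> real measure" where
  "spectral_measure L n = measure_pmf (pmf_of_multiset (proots (char_poly (rauzy_adj_matrix L n))))"

definition arcsine_measure :: "real measure" where
  "arcsine_measure = density lborel
     (\<lambda>x. ennreal (indicator {-2<..<2} x / (pi * sqrt (4 - x\<^sup>2))))"

end

theory Submission
  imports Defs "Jordan_Normal_Form.Schur_Decomposition"
begin

text \<open>
  Every condition is equivalent to \<open>p(n+1)/p(n) \<rightarrow> 1\<close>. The arcs of the \<open>n\<close>-th Rauzy graph are the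
  words of length \<open>n + 1\<close>, so \<open>2 p(n+1)/p(n)\<close> is its mean degree. This is a local quantity, and up to
  \<open>O(1/p(n))\<close> it is also the second spectral moment, because loops and 2-cycles only occur at periodic
  words, of which there are boundedly many. Hence a Benjamini--Schramm limit or a weak limit of spectral
  measures makes \<open>p(n+1)/p(n)\<close> converge, and subexponential growth forces the limit to be 1.

  Conversely, if the mean degree tends to 2, almost prolongability makes almost all vertices have in-
  and out-degree 1, and bounded degree makes this hold on the whole \<open>r\<close>-ball of almost all vertices.
  Such a ball is a directed path unless its centre is a word of small period, and \<open>p(n) \<rightarrow> \<infinity>\<close>. On a path the
  Chebyshev polynomial \<open>C\<^sub>m\<close> with \<open>C\<^sub>m(2 cos t) = 2 cos(m t)\<close> of the adjacency operator \<open>S + S\<inverse>\<close> is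
  \<open>S\<^sup>m + S\<^sup>-\<^sup>m\<close>, which has zero diagonal; so all Chebyshev moments tend to those of the arcsine law.
\<close>

section \<open>Words, degrees and regular vertices\<close>

text \<open>A mean degree near 2 alone says little: vertices of degree 0 could pay for branching
  ones. Almost prolongability makes degree 0 rare; every other vertex has degree at least 1 and the
  total excess over 1 is small, so almost all degrees equal 1. The price of assuming only almost
  prolongability is that \<open>p\<close> need not be monotone:
  \<open>p(n) \<rightarrow> \<infinity>\<close> has to be deduced from unboundedness, and the limit
  of the ratio is kept away from 0 by counting right-prolongable words. Once degrees are 1,
  periodicity is the only obstruction to a line, because a vertex is a window on a longer word:
  meeting the same window again after \<open>m\<close> steps means that it overlaps itself with
  shift \<open>m\<close>, and the number of such windows is bounded independently of
  \<open>n\<close>. A weak limit is tested on bounded functions only, so the uniform degree bound,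
  which confines all spectra to one interval, is what gives access to the second moment.\<close>

definition word_periodic :: "nat \<Rightarrow> 'a list \<Rightarrow> bool" where
  "word_periodic m w \<longleftrightarrow> (\<forall>t. t + m < length w \<longrightarrow> w ! (t + m) = w ! t)"

lemma word_periodic_eqI:
  assumes "word_periodic m v" "word_periodic m w" "length v = length w" "0 < m"
    and "take m v = take m w"
  shows "v = w"
proof (rule nth_equalityI)
  show "v ! t = w ! t" if "t < length v" for t
    using that
  proof (induction t rule: less_induct)
    case (less t)
    show ?case
    proof (cases "t < m")
      case True
      then show ?thesis using assms(5) by (metis nth_take)
    next
      case False
      with less.IH[of "t - m"] less.prems assms(1,2,3,4) show ?thesis
        unfolding word_periodic_def
        by (metis diff_add diff_less le_add_diff_inverse2 less_imp_diff_less not_less not_less_zero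
            order_le_less_trans zero_le)
    qed
  qed
qed (use assms in simp)

lemma finite_words_length_eq [simp]: "finite {w :: 'a::finite list. length w = n}"
  using finite_lists_length_eq[of "UNIV :: 'a set" n] by simp

text \<open>Such a word is determined by its first \<open>m\<close> letters, so the bound is
  independent of \<open>n\<close>; against \<open>p(n) \<rightarrow> \<infinity>\<close> periodic
  words become negligible.\<close>

lemma card_word_periodic_le:
  assumes "0 < m"
  shows "card {w :: 'a::finite list. length w = n \<and> word_periodic m w} \<le> CARD('a) ^ m"
proof -
  let ?S = "{w :: 'a list. length w = n \<and> word_periodic m w}"
  have "inj_on (take m) ?S"
  proof (rule inj_onI)
    fix v w assume "v \<in> ?S" "w \<in> ?S" "take m v = take m w"
    then show "v = w" by (intro word_periodic_eqI[of m v w] assms) auto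
  qed
  moreover have "take m ` ?S \<subseteq> {w. length w = min n m}" by auto
  ultimately have "card ?S \<le> card {w :: 'a list. length w = min n m}"
    by (intro card_inj_on_le[of "take m"]) auto
  also have "\<dots> = CARD('a) ^ min n m"
    using card_lists_length_eq[of "UNIV :: 'a set" "min n m"] by simp
  also have "\<dots> \<le> CARD('a) ^ m"
    by (intro power_increasing) (auto simp: Suc_le_eq)
  finally show ?thesis .
qed

definition out_deg :: "'a list set \<Rightarrow> 'a list \<Rightarrow> nat" where
  "out_deg L v = card {b. v @ [b] \<in> L}"

definition in_deg :: "'a list set \<Rightarrow> 'a list \<Rightarrow> nat" where
  "in_deg L v = card {a. a # v \<in> L}"

lemma deg_le_card:
  fixes v :: "'a::finite list"
  shows "out_deg L v \<le> CARD('a)" "in_deg L v \<le> CARD('a)"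
  by (auto simp: out_deg_def in_deg_def intro: card_mono)

lemma deg_0_iff:
  fixes v :: "'a::finite list"
  shows "out_deg L v = 0 \<longleftrightarrow> \<not> right_prolongable L v" "in_deg L v = 0 \<longleftrightarrow> \<not> left_prolongable L v"
  by (auto simp: out_deg_def in_deg_def right_prolongable_def left_prolongable_def)

text \<open>The window moved one letter to the right. The \<open>THE\<close> is meaningful only
  where the right extension is unique, that is for \<open>out_deg L v = 1\<close>;
  \<open>word_pred\<close> is the mirror image.\<close>

definition word_succ :: "'a list set \<Rightarrow> 'a list \<Rightarrow> 'a list" where
  "word_succ L v = tl v @ [THE b. v @ [b] \<in> L]"

definition word_pred :: "'a list set \<Rightarrow> 'a list \<Rightarrow> 'a list" where
  "word_pred L v = (THE a. a # v \<in> L) # butlast v"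

text \<open>\<open>M\<close> bounds the excluded periods; it is later chosen at least as large as
  the length of the paths that must not close up. A word of length at most \<open>m\<close> is
  vacuously \<open>m\<close>-periodic, so no nonempty word of length at most \<open>M\<close> is
  regular.\<close>

definition regular_words :: "'a list set \<Rightarrow> nat \<Rightarrow> nat \<Rightarrow> 'a list set" where
  "regular_words L M n = {v \<in> lang_n L n. out_deg L v = 1 \<and> in_deg L v = 1 \<and>
     (\<forall>m\<in>{1..M}. \<not> word_periodic m v)}"

text \<open>Depth \<open>r\<close> says that every sequence of at most \<open>r\<close> steps of
  \<open>word_succ\<close> and \<open>word_pred\<close>, in any order, stays among regular words.
  The recursive form lets a bad vertex be charged to a bad neighbour of the previous depth.\<close>

primrec deep_words :: "'a list set \<Rightarrow> nat \<Rightarrow> nat \<Rightarrow> nat \<Rightarrow> 'a list set" where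
  "deep_words L M n 0 = regular_words L M n"
| "deep_words L M n (Suc r) =
     {v \<in> deep_words L M n r. word_succ L v \<in> deep_words L M n r \<and> word_pred L v \<in> deep_words L M n r}"

lemma finite_lang_n [simp]: "finite (lang_n (L :: 'a::finite list set) n)"
  by (rule finite_subset[OF _ finite_words_length_eq[of n]]) (auto simp: lang_n_def)

lemma deep_words_subset:
  "deep_words L M n r \<subseteq> regular_words L M n" "deep_words L M n r \<subseteq> lang_n L n"
proof -
  show *: "deep_words L M n r \<subseteq> regular_words L M n" by (induction r) auto
  show "deep_words L M n r \<subseteq> lang_n L n" using * by (auto simp: regular_words_def)
qed

section \<open>Degrees and window shifts in a factorial language\<close>

locale factorial_language =
  fixes L :: "'a::finite list set"
  assumes factorial: "factorial_lang L"
begin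

lemma infix_in_L: "u @ x @ v \<in> L \<Longrightarrow> x \<in> L"
  using factorial unfolding factorial_lang_def by blast

lemma prefix_in_L: "x @ v \<in> L \<Longrightarrow> x \<in> L"
  using infix_in_L[of "[]" x v] by simp

lemma suffix_in_L: "u @ x \<in> L \<Longrightarrow> x \<in> L"
  using infix_in_L[of u x "[]"] by simp

lemma tl_butlast_lang_n:
  assumes "w \<in> lang_n L (Suc n)"
  shows "tl w \<in> lang_n L n" "butlast w \<in> lang_n L n"
proof -
  have "w \<noteq> []" using assms by (auto simp: lang_n_def)
  then have "[hd w] @ tl w \<in> L" "butlast w @ [last w] \<in> L"
    using assms by (auto simp: lang_n_def)
  from suffix_in_L[OF this(1)] prefix_in_L[OF this(2)]
  show "tl w \<in> lang_n L n" "butlast w \<in> lang_n L n"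
    using assms by (auto simp: lang_n_def)
qed

text \<open>Factoriality makes the condition on the two endpoints automatic, so counting arcs is
  counting words.\<close>

lemma rauzy_arcs_eq: "rauzy_arcs L n = lang_n L (Suc n)"
  unfolding rauzy_arcs_def using tl_butlast_lang_n by fastforce

lemma finite_rauzy_arcs [simp]: "finite (rauzy_arcs L n)"
  by (simp add: rauzy_arcs_eq)

lemma out_arcs_eq:
  assumes "v \<in> lang_n L n"
  shows "{w \<in> rauzy_arcs L n. butlast w = v} = (\<lambda>b. v @ [b]) ` {b. v @ [b] \<in> L}"
proof -
  have "w = butlast w @ [last w]" if "w \<in> lang_n L (Suc n)" for w
    using that by (cases w rule: rev_cases) (auto simp: lang_n_def)
  then have "w \<in> (\<lambda>b. v @ [b]) ` {b. v @ [b] \<in> L}" if "w \<in> lang_n L (Suc n)" "butlast w = v" for w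
    using that by (intro image_eqI[of _ _ "last w"]) (metis, simp add: lang_n_def, metis)
  then show ?thesis using assms by (auto simp: rauzy_arcs_eq lang_n_def)
qed

lemma in_arcs_eq:
  assumes "v \<in> lang_n L n"
  shows "{w \<in> rauzy_arcs L n. tl w = v} = (\<lambda>a. a # v) ` {a. a # v \<in> L}"
proof -
  have "w = hd w # tl w" if "w \<in> lang_n L (Suc n)" for w
    using that by (cases w) (auto simp: lang_n_def)
  then have "w \<in> (\<lambda>a. a # v) ` {a. a # v \<in> L}" if "w \<in> lang_n L (Suc n)" "tl w = v" for w
    using that by (intro image_eqI[of _ _ "hd w"]) (metis, simp add: lang_n_def, metis)
  then show ?thesis using assms by (auto simp: rauzy_arcs_eq lang_n_def)
qed

lemma card_out_arcs: "v \<in> lang_n L n \<Longrightarrow> card {w \<in> rauzy_arcs L n. butlast w = v} = out_deg L v"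
  by (simp add: out_arcs_eq card_image inj_on_def out_deg_def)

lemma card_in_arcs: "v \<in> lang_n L n \<Longrightarrow> card {w \<in> rauzy_arcs L n. tl w = v} = in_deg L v"
  by (simp add: in_arcs_eq card_image inj_on_def in_deg_def)

lemma sum_out_deg: "(\<Sum>v\<in>lang_n L n. out_deg L v) = complexity L (Suc n)"
proof -
  have "rauzy_arcs L n = (\<Union>v\<in>lang_n L n. {w \<in> rauzy_arcs L n. butlast w = v})"
    unfolding rauzy_arcs_eq using tl_butlast_lang_n by blast
  then have "complexity L (Suc n) = card (\<Union>v\<in>lang_n L n. {w \<in> rauzy_arcs L n. butlast w = v})"
    by (simp add: complexity_def rauzy_arcs_eq)
  also have "\<dots> = (\<Sum>v\<in>lang_n L n. card {w \<in> rauzy_arcs L n. butlast w = v})"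
    by (intro card_UN_disjoint) auto
  finally show ?thesis by (simp add: card_out_arcs)
qed

lemma sum_in_deg: "(\<Sum>v\<in>lang_n L n. in_deg L v) = complexity L (Suc n)"
proof -
  have "rauzy_arcs L n = (\<Union>v\<in>lang_n L n. {w \<in> rauzy_arcs L n. tl w = v})"
    unfolding rauzy_arcs_eq using tl_butlast_lang_n by blast
  then have "complexity L (Suc n) = card (\<Union>v\<in>lang_n L n. {w \<in> rauzy_arcs L n. tl w = v})"
    by (simp add: complexity_def rauzy_arcs_eq)
  also have "\<dots> = (\<Sum>v\<in>lang_n L n. card {w \<in> rauzy_arcs L n. tl w = v})"
    by (intro card_UN_disjoint) auto
  finally show ?thesis by (simp add: card_in_arcs)
qed

lemma regular_succ:
  assumes "v \<in> regular_words L M n" "0 < n"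
  obtains b where "{b. v @ [b] \<in> L} = {b}" "word_succ L v = tl v @ [b]" "word_succ L v \<in> lang_n L n"
    "{w \<in> rauzy_arcs L n. butlast w = v} = {v @ [b]}"
proof -
  obtain b where b: "{b. v @ [b] \<in> L} = {b}"
    using assms by (auto simp: regular_words_def out_deg_def card_1_singleton_iff)
  have v: "v \<in> lang_n L n" using assms by (simp add: regular_words_def)
  have "(THE b. v @ [b] \<in> L) = b" using b by blast
  then have s: "word_succ L v = tl v @ [b]" by (simp add: word_succ_def)
  have "tl (v @ [b]) \<in> lang_n L n"
    using b v by (intro tl_butlast_lang_n) (auto simp: lang_n_def)
  moreover have "v \<noteq> []" using v assms(2) by (auto simp: lang_n_def)
  ultimately have "word_succ L v \<in> lang_n L n" using s by simp
  then show ?thesis using that[OF b s] b out_arcs_eq[OF v] by simp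
qed

lemma regular_pred:
  assumes "v \<in> regular_words L M n" "0 < n"
  obtains a where "{a. a # v \<in> L} = {a}" "word_pred L v = a # butlast v" "word_pred L v \<in> lang_n L n"
    "{w \<in> rauzy_arcs L n. tl w = v} = {a # v}"
proof -
  obtain a where a: "{a. a # v \<in> L} = {a}"
    using assms by (auto simp: regular_words_def in_deg_def card_1_singleton_iff)
  have v: "v \<in> lang_n L n" using assms by (simp add: regular_words_def)
  have "(THE a. a # v \<in> L) = a" using a by blast
  then have s: "word_pred L v = a # butlast v" by (simp add: word_pred_def)
  have "butlast (a # v) \<in> lang_n L n"
    using a v by (intro tl_butlast_lang_n) (auto simp: lang_n_def)
  moreover have "v \<noteq> []" using v assms(2) by (auto simp: lang_n_def)
  ultimately have "word_pred L v \<in> lang_n L n" using s by simp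
  then show ?thesis using that[OF a s] a in_arcs_eq[OF v] by simp
qed

text \<open>\<open>v\<close> extends \<open>word_pred L v\<close> on the right by its last letter,
  and regularity of the predecessor leaves no other extension.\<close>

lemma succ_pred:
  assumes "v \<in> regular_words L M n" "word_pred L v \<in> regular_words L M n" "0 < n"
  shows "word_succ L (word_pred L v) = v"
proof -
  obtain a where a: "{a. a # v \<in> L} = {a}" "word_pred L v = a # butlast v"
    using regular_pred[OF assms(1,3)] by metis
  obtain b where b: "{b. word_pred L v @ [b] \<in> L} = {b}"
    "word_succ L (word_pred L v) = tl (word_pred L v) @ [b]"
    using regular_succ[OF assms(2,3)] by metis
  have "v \<noteq> []" using assms by (auto simp: regular_words_def lang_n_def)
  then have "word_pred L v @ [last v] \<in> L" using a by auto
  then have "b = last v" using b(1) by (metis mem_Collect_eq singletonD)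
  then show ?thesis using a b \<open>v \<noteq> []\<close> by simp
qed

lemma pred_succ:
  assumes "v \<in> regular_words L M n" "word_succ L v \<in> regular_words L M n" "0 < n"
  shows "word_pred L (word_succ L v) = v"
proof -
  obtain b where b: "{b. v @ [b] \<in> L} = {b}" "word_succ L v = tl v @ [b]"
    using regular_succ[OF assms(1,3)] by metis
  obtain a where a: "{a. a # word_succ L v \<in> L} = {a}"
    "word_pred L (word_succ L v) = a # butlast (word_succ L v)"
    using regular_pred[OF assms(2,3)] by metis
  have "v \<noteq> []" using assms by (auto simp: regular_words_def lang_n_def)
  moreover have "v @ [b] \<in> L" using b by blast
  ultimately have "hd v # word_succ L v \<in> L"
    using b(2) by (cases v) auto
  then have "a = hd v" using a(1) by (metis mem_Collect_eq singletonD)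
  then show ?thesis using a b \<open>v \<noteq> []\<close> by simp
qed

text \<open>A word lost at this step has a successor or predecessor that was already bad. From that
  neighbour it is recovered by dropping a letter at one end and adding one at the other, so each bad
  word accounts for at most \<open>CARD('a)\<close> losses on either side.\<close>

lemma card_not_deep_Suc_le:
  assumes "0 < n"
  shows "card (lang_n L n - deep_words L M n (Suc r))
    \<le> (1 + 2 * CARD('a)) * card (lang_n L n - deep_words L M n r)"
proof -
  let ?U = "deep_words L M n r"
  let ?B = "lang_n L n - ?U"
  let ?f = "\<lambda>(a :: 'a, x). a # butlast x" and ?g = "\<lambda>(b :: 'a, x). tl x @ [b]"
  have "lang_n L n - deep_words L M n (Suc r) \<subseteq> ?B \<union> (?f ` (UNIV \<times> ?B) \<union> ?g ` (UNIV \<times> ?B))"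
  proof
    fix v assume v: "v \<in> lang_n L n - deep_words L M n (Suc r)"
    consider "v \<in> ?B" | "v \<in> ?U" "word_succ L v \<notin> ?U" | "v \<in> ?U" "word_pred L v \<notin> ?U"
      using v by auto
    then show "v \<in> ?B \<union> (?f ` (UNIV \<times> ?B) \<union> ?g ` (UNIV \<times> ?B))"
    proof cases
      case 2
      have ne: "v \<noteq> []" using v assms by (auto simp: lang_n_def)
      obtain b where b: "word_succ L v = tl v @ [b]" "word_succ L v \<in> lang_n L n"
        using regular_succ[OF subsetD[OF deep_words_subset(1) 2(1)] assms] by metis
      then have "v = ?f (hd v, word_succ L v)" using ne by simp
      moreover have "(hd v, word_succ L v) \<in> UNIV \<times> ?B" using b 2 by simp
      ultimately show ?thesis by blast
    next
      case 3
      have ne: "v \<noteq> []" using v assms by (auto simp: lang_n_def)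
      obtain b where b: "word_pred L v = b # butlast v" "word_pred L v \<in> lang_n L n"
        using regular_pred[OF subsetD[OF deep_words_subset(1) 3(1)] assms] by metis
      then have "v = ?g (last v, word_pred L v)" using ne by simp
      moreover have "(last v, word_pred L v) \<in> UNIV \<times> ?B" using b 3 by simp
      ultimately show ?thesis by blast
    qed simp
  qed
  then have "card (lang_n L n - deep_words L M n (Suc r))
      \<le> card (?B \<union> (?f ` (UNIV \<times> ?B) \<union> ?g ` (UNIV \<times> ?B)))"
    by (intro card_mono) auto
  also have "\<dots> \<le> card ?B + (card (?f ` (UNIV \<times> ?B)) + card (?g ` (UNIV \<times> ?B)))"
    by (meson add_left_mono card_Un_le le_trans)
  also have "\<dots> \<le> card ?B + (card ((UNIV :: 'a set) \<times> ?B) + card ((UNIV :: 'a set) \<times> ?B))"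
    by (intro add_mono card_image_le) auto
  also have "\<dots> = (1 + 2 * CARD('a)) * card ?B"
    by (simp add: card_cartesian_product algebra_simps)
  finally show ?thesis .
qed

lemma card_not_deep_le:
  assumes "0 < n"
  shows "card (lang_n L n - deep_words L M n r)
    \<le> (1 + 2 * CARD('a)) ^ r * card (lang_n L n - regular_words L M n)"
proof (induction r)
  case (Suc r)
  have "card (lang_n L n - deep_words L M n (Suc r))
      \<le> (1 + 2 * CARD('a)) * card (lang_n L n - deep_words L M n r)"
    by (rule card_not_deep_Suc_le[OF assms])
  also have "\<dots> \<le> (1 + 2 * CARD('a)) * ((1 + 2 * CARD('a)) ^ r * card (lang_n L n - regular_words L M n))"
    by (intro mult_left_mono Suc) auto
  finally show ?case by (simp add: algebra_simps)
qed simp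

text \<open>Both degrees sum to \<open>p(n+1)\<close>, so their total excess over 1 is
  \<open>p(n+1) - p(n)\<close>; the zeros, which lower this sum, are the non-prolongable words and
  are counted separately. The last term counts words of period at most \<open>M\<close>.\<close>

lemma card_not_regular_le:
  "real (card (lang_n L n - regular_words L M n)) \<le>
     2 * (real (complexity L (Suc n)) - real (complexity L n))
     + 2 * (real (complexity L n) - card {v \<in> lang_n L n. left_prolongable L v})
     + 2 * (real (complexity L n) - card {v \<in> lang_n L n. right_prolongable L v})
     + real (\<Sum>m\<in>{1..M}. CARD('a) ^ m)"
proof -
  let ?V = "lang_n L n"
  let ?O = "{v \<in> ?V. out_deg L v \<noteq> 1}" and ?I = "{v \<in> ?V. in_deg L v \<noteq> 1}"
  let ?P = "\<Union>m\<in>{1..M}. {w :: 'a list. length w = n \<and> word_periodic m w}"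
  have key: "real (card {v \<in> ?V. d v \<noteq> 1}) \<le>
      (\<Sum>v\<in>?V. real (d v)) - card ?V + 2 * (card ?V - real (card {v \<in> ?V. d v \<noteq> 0}))"
    for d :: "'a list \<Rightarrow> nat"
  proof -
    have "real (card {v \<in> ?V. d v \<noteq> 1}) = (\<Sum>v\<in>?V. if d v \<noteq> 1 then 1 else 0)"
      by (simp add: sum.If_cases Int_def)
    \<comment> \<open>Pointwise: a vertex of degree 0 contributes \<open>-1 + 2\<close>, one of
      degree 1 contributes 0, and any other at least 1; hence the factor 2 on the zeros.\<close>
    also have "\<dots> \<le> (\<Sum>v\<in>?V. real (d v) - 1 + 2 * (1 - (if d v \<noteq> 0 then 1 else 0)))"
      by (intro sum_mono) auto
    also have "\<dots> = (\<Sum>v\<in>?V. real (d v)) - card ?V + 2 * (real (card ?V) - (\<Sum>v\<in>?V. (if d v \<noteq> 0 then 1 else 0)))"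
      by (simp add: sum.distrib sum_subtractf sum_distrib_left[symmetric] del: mult_Suc_right)
    also have "(\<Sum>v\<in>?V. (if d v \<noteq> 0 then 1 else 0 :: real)) = real (card {v \<in> ?V. d v \<noteq> 0})"
      by (simp add: sum.If_cases Int_def)
    finally show ?thesis .
  qed
  have "?V - regular_words L M n \<subseteq> ?O \<union> (?I \<union> ?P)"
    by (auto simp: regular_words_def lang_n_def)
  then have "card (?V - regular_words L M n) \<le> card (?O \<union> (?I \<union> ?P))"
    by (intro card_mono) auto
  also have "\<dots> \<le> card ?O + (card ?I + card ?P)"
    by (meson add_left_mono card_Un_le le_trans)
  also have "card ?P \<le> (\<Sum>m\<in>{1..M}. card {w :: 'a list. length w = n \<and> word_periodic m w})"
    by (rule card_UN_le) simp
  also have "\<dots> \<le> (\<Sum>m\<in>{1..M}. CARD('a) ^ m)"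
    by (intro sum_mono card_word_periodic_le) simp
  finally have le: "real (card (?V - regular_words L M n))
      \<le> real (card ?O) + (real (card ?I) + real (\<Sum>m\<in>{1..M}. CARD('a) ^ m))"
    by (simp only: of_nat_add[symmetric] of_nat_le_iff)
  have O: "real (card ?O) \<le> real (complexity L (Suc n)) - complexity L n
     + 2 * (real (complexity L n) - card {v \<in> lang_n L n. right_prolongable L v})"
    using key[of "out_deg L"] sum_out_deg[of n]
    by (simp add: deg_0_iff complexity_def of_nat_sum[symmetric] del: of_nat_sum)
  have I: "real (card ?I) \<le> real (complexity L (Suc n)) - complexity L n
     + 2 * (real (complexity L n) - card {v \<in> lang_n L n. left_prolongable L v})"
    using key[of "in_deg L"] sum_in_deg[of n]
    by (simp add: deg_0_iff complexity_def of_nat_sum[symmetric] del: of_nat_sum)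
  have arith: "a \<le> x + (y + z) \<Longrightarrow> x \<le> s - p + 2 * (p - r) \<Longrightarrow> y \<le> s - p + 2 * (p - l) \<Longrightarrow>
      a \<le> 2 * (s - p) + 2 * (p - l) + 2 * (p - r) + z" for a x y z s p r l :: real
    by (simp add: algebra_simps)
  show ?thesis by (rule arith[OF le O I])
qed

text \<open>Each right-prolongable word has an out-arc of its own. This takes the place of
  monotonicity of \<open>p\<close>, which may fail when some words cannot be prolonged.\<close>

lemma card_right_prolongable_le: "card {v \<in> lang_n L n. right_prolongable L v} \<le> complexity L (Suc n)"
proof -
  have "card {v \<in> lang_n L n. right_prolongable L v} = (\<Sum>v\<in>lang_n L n. if out_deg L v = 0 then 0 else 1)"
    by (simp add: sum.If_cases Int_def deg_0_iff)
  also have "\<dots> \<le> (\<Sum>v\<in>lang_n L n. out_deg L v)" by (intro sum_mono) auto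
  finally show ?thesis by (simp add: sum_out_deg)
qed

end

section \<open>Consequences of almost prolongability and unboundedness\<close>

locale almost_prolongable_language = factorial_language L for L :: "'a::finite list set" +
  assumes almost_prolongable: "almost_prolongable L"
    and unbounded: "\<not> bdd_above (range (complexity L))"
begin

text \<open>An empty level stays empty, since a longer word would have a suffix in it; only finitely
  many values of \<open>p\<close> would then be nonzero, against unboundedness.\<close>

lemma complexity_pos: "0 < complexity L n"
proof (rule ccontr)
  assume "\<not> 0 < complexity L n"
  then have empty: "lang_n L n = {}" by (simp add: complexity_def)
  have "complexity L m = 0" if "n \<le> m" for m
  proof -
    have "lang_n L m = {}" using that
    proof (induction m rule: dec_induct)
      case (step m)
      then show ?case using tl_butlast_lang_n(1) by blast
    qed (fact empty)
    then show ?thesis by (simp add: complexity_def)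
  qed
  then have "complexity L m \<le> Max (complexity L ` {..n})" for m
    by (cases "n \<le> m") (auto intro: Max_ge)
  then have "bdd_above (range (complexity L))" by (rule bdd_aboveI2)
  then show False using unbounded by simp
qed

lemma right_prolongable_ratio:
  "(\<lambda>n. real (card {v \<in> lang_n L n. right_prolongable L v}) / real (complexity L n)) \<longlonglongrightarrow> 1"
  and left_prolongable_ratio:
  "(\<lambda>n. real (card {v \<in> lang_n L n. left_prolongable L v}) / real (complexity L n)) \<longlonglongrightarrow> 1"
  using almost_prolongable by (auto simp: almost_prolongable_def)

text \<open>If a small value \<open>C\<close> is taken far out, almost all words one step earlier are right-prolongable,
  so there are at most \<open>2 C\<close> of them, so all of them are right-prolongable, so there are at most \<open>C\<close>.\<close>

lemma complexity_at_top: "filterlim (complexity L) at_top sequentially"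
proof (rule ccontr)
  assume "\<not> filterlim (complexity L) at_top sequentially"
  then obtain C where "\<not> (\<forall>\<^sub>F n in sequentially. C \<le> complexity L n)"
    unfolding filterlim_at_top by blast
  then have freq: "\<exists>m\<ge>N. complexity L m < C" for N
    unfolding eventually_sequentially by (meson not_le)
  have C: "0 < C" using freq[of 0] by auto
  \<comment> \<open>For \<open>p(n) < 2 C\<close> this gives \<open>e p(n) < 1\<close>, less than
    one exception, so by integrality every word is right-prolongable. The bound
    \<open>e \<le> 1/2\<close> is what yields \<open>p(n) < 2 C\<close> in the first place.\<close>
  define e where "e = 1 / (2 * real C)"
  have e: "0 < e" "e \<le> 1/2" using C by (auto simp: e_def field_simps)
  have "\<forall>\<^sub>F n in sequentially. real (card {v \<in> lang_n L n. right_prolongable L v}) / real (complexity L n) > 1 - e"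
    using right_prolongable_ratio e by (intro order_tendstoD) auto
  then obtain N where N: "\<And>n. n \<ge> N \<Longrightarrow>
      real (card {v \<in> lang_n L n. right_prolongable L v}) > (1 - e) * real (complexity L n)"
    using complexity_pos by (auto simp: eventually_sequentially field_simps)
  have step_down: "complexity L n < C" if n: "N \<le> n" "complexity L (Suc n) < C" for n
  proof -
    let ?p = "complexity L n" and ?c = "card {v \<in> lang_n L n. right_prolongable L v}"
    have c: "?c < C" using card_right_prolongable_le[of n] n by simp
    have "1 / 2 * real ?p \<le> (1 - e) * real ?p" by (intro mult_right_mono) (use e in auto)
    then have "real ?p < 2 * real C" using N[OF n(1)] c by linarith
    then have "e * real ?p < 1" using C by (simp add: e_def field_simps)
    then have "real ?p - 1 < real ?c" using N[OF n(1)] by (simp add: algebra_simps)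
    then show ?thesis using c by linarith
  qed
  have small: "complexity L n < C" if "N \<le> n" for n
  proof -
    \<comment> \<open>Small values occur arbitrarily far out, so beyond every
      \<open>n \<ge> N\<close> there is one, and \<open>step_down\<close> descends from it to
      \<open>n\<close>.\<close>
    obtain m where m: "m \<ge> n" "complexity L m < C" using freq by blast
    from m(1) show ?thesis
    proof (induction n rule: inc_induct)
      case (step k)
      have "N \<le> k" using step.hyps that by simp
      then show ?case using step_down step.IH by blast
    qed (use m in simp)
  qed
  then have "complexity L m \<le> max C (Max (complexity L ` {..N}))" for m
    by (cases "N \<le> m") (auto intro: Max_ge less_imp_le simp: le_max_iff_disj)
  then have "bdd_above (range (complexity L))" by (rule bdd_aboveI2)
  then show False using unbounded by simp
qed

lemma inverse_complexity_tendsto_0: "(\<lambda>n. c / real (complexity L n)) \<longlonglongrightarrow> 0"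
proof -
  have "filterlim (\<lambda>n. real (complexity L n)) at_top sequentially"
    by (rule filterlim_compose[OF filterlim_real_sequentially complexity_at_top])
  then show ?thesis
    by (intro tendsto_divide_0[OF tendsto_const] filterlim_at_top_imp_at_infinity)
qed

lemma not_deep_ratio_tendsto_0:
  assumes "(\<lambda>n. real (complexity L (n + 1)) / real (complexity L n)) \<longlonglongrightarrow> 1"
  shows "(\<lambda>n. real (card (lang_n L n - deep_words L M n r)) / real (complexity L n)) \<longlonglongrightarrow> 0"
proof -
  let ?p = "\<lambda>n. real (complexity L n)"
  let ?lp = "\<lambda>n. real (card {v \<in> lang_n L n. left_prolongable L v})"
  let ?rp = "\<lambda>n. real (card {v \<in> lang_n L n. right_prolongable L v})"
  let ?K = "real (\<Sum>m\<in>{1..M}. CARD('a) ^ m)" and ?D = "real ((1 + 2 * CARD('a)) ^ r)"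
  let ?F = "\<lambda>n. ?D * (2 * (?p (n + 1) / ?p n - 1) + 2 * (1 - ?lp n / ?p n) + 2 * (1 - ?rp n / ?p n) + ?K / ?p n)"
  have "?F \<longlonglongrightarrow> ?D * (2 * (1 - 1) + 2 * (1 - 1) + 2 * (1 - 1) + 0)"
    by (intro tendsto_intros assms right_prolongable_ratio left_prolongable_ratio inverse_complexity_tendsto_0)
  then have F: "?F \<longlonglongrightarrow> 0" by simp
  have "real (card (lang_n L n - deep_words L M n r)) / ?p n \<le> ?F n" if "0 < n" for n
  proof -
    have p: "0 < ?p n" using complexity_pos by simp
    have "real (card (lang_n L n - deep_words L M n r)) \<le> ?D * real (card (lang_n L n - regular_words L M n))"
      using card_not_deep_le[OF that, of M r] by (metis of_nat_le_iff of_nat_mult)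
    also have "\<dots> \<le> ?D * (2 * (?p (Suc n) - ?p n) + 2 * (?p n - ?lp n) + 2 * (?p n - ?rp n) + ?K)"
      by (intro mult_left_mono card_not_regular_le) auto
    also have "\<dots> = ?F n * ?p n" using p by (simp add: field_simps)
    finally show ?thesis using p by (subst pos_divide_le_eq)
  qed
  then show ?thesis
    by (intro real_tendsto_sandwich[OF _ _ tendsto_const F])
       (auto simp: eventually_sequentially intro!: exI[of _ 1])
qed

end

section \<open>Rooted isomorphisms and balls\<close>

text \<open>A flag covers both kinds of graph so that each fact on isomorphisms is proved once.
  Unoriented ends are compared as a set; a loop gives a singleton and can only match a loop.\<close>

definition same_ends :: "bool \<Rightarrow> 'v \<Rightarrow> 'v \<Rightarrow> 'v \<Rightarrow> 'v \<Rightarrow> bool" where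
  "same_ends d a b a' b' \<longleftrightarrow> (if d then a = a' \<and> b = b' else {a, b} = {a', b'})"

definition rooted_iso ::
  "bool \<Rightarrow> 'v set \<Rightarrow> 'e set \<Rightarrow> ('e \<Rightarrow> 'v) \<Rightarrow> ('e \<Rightarrow> 'v) \<Rightarrow> 'v \<Rightarrow>
   'w set \<Rightarrow> 'f set \<Rightarrow> ('f \<Rightarrow> 'w) \<Rightarrow> ('f \<Rightarrow> 'w) \<Rightarrow> 'w \<Rightarrow> bool" where
  "rooted_iso d V E t h r V' E' t' h' r' \<longleftrightarrow>
     (\<exists>f g. bij_betw f V V' \<and> bij_betw g E E' \<and> f r = r' \<and>
        (\<forall>e\<in>E. same_ends d (f (t e)) (f (h e)) (t' (g e)) (h' (g e))))"

definition wf_rooted :: "'v set \<Rightarrow> 'e set \<Rightarrow> ('e \<Rightarrow> 'v) \<Rightarrow> ('e \<Rightarrow> 'v) \<Rightarrow> 'v \<Rightarrow> bool" where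
  "wf_rooted V E t h r \<longleftrightarrow> r \<in> V \<and> (\<forall>e\<in>E. t e \<in> V \<and> h e \<in> V)"

text \<open>A loop at the root counts twice, once for each end. Counting ends of both kinds together
  makes the number invariant under isomorphisms that reverse edges.\<close>

definition root_deg :: "'e set \<Rightarrow> ('e \<Rightarrow> 'v) \<Rightarrow> ('e \<Rightarrow> 'v) \<Rightarrow> 'v \<Rightarrow> nat" where
  "root_deg E t h r = card {e \<in> E. t e = r} + card {e \<in> E. h e = r}"

lemma rooted_iso_dir_imp: "rooted_iso True V E t h r V' E' t' h' r' \<Longrightarrow> rooted_iso d V E t h r V' E' t' h' r'"
  unfolding rooted_iso_def same_ends_def by (cases d) (simp, fastforce)

lemma same_ends_image: "same_ends d a b a' b' \<Longrightarrow> same_ends d (f a) (f b) (f a') (f b')"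
  by (auto simp: same_ends_def doubleton_eq_iff split: if_splits)

lemma same_ends_trans: "same_ends d a b a' b' \<Longrightarrow> same_ends d a' b' a'' b'' \<Longrightarrow> same_ends d a b a'' b''"
  by (auto simp: same_ends_def split: if_splits)

lemma same_ends_sym: "same_ends d a b a' b' \<Longrightarrow> same_ends d a' b' a b"
  by (auto simp: same_ends_def split: if_splits)

lemma same_ends_count:
  "same_ends d a b a' b' \<Longrightarrow> (if a = x then 1 else 0) + (if b = x then 1 else 0 :: nat)
     = (if a' = x then 1 else 0) + (if b' = x then 1 else 0)"
  by (cases d) (auto simp: same_ends_def doubleton_eq_iff)

lemma rooted_iso_trans:
  assumes "rooted_iso d V E t h r V' E' t' h' r'" "rooted_iso d V' E' t' h' r' V'' E'' t'' h'' r''"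
  shows "rooted_iso d V E t h r V'' E'' t'' h'' r''"
proof -
  obtain f g where 1: "bij_betw f V V'" "bij_betw g E E'" "f r = r'"
    "\<And>e. e \<in> E \<Longrightarrow> same_ends d (f (t e)) (f (h e)) (t' (g e)) (h' (g e))"
    using assms(1) unfolding rooted_iso_def by blast
  obtain f' g' where 2: "bij_betw f' V' V''" "bij_betw g' E' E''" "f' r' = r''"
    "\<And>e. e \<in> E' \<Longrightarrow> same_ends d (f' (t' e)) (f' (h' e)) (t'' (g' e)) (h'' (g' e))"
    using assms(2) unfolding rooted_iso_def by blast
  have "same_ends d (f' (f (t e))) (f' (f (h e))) (t'' (g' (g e))) (h'' (g' (g e)))" if "e \<in> E" for e
    using same_ends_trans[OF same_ends_image[OF 1(4)[OF that]] 2(4)] bij_betwE[OF 1(2)] that by blast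
  then show ?thesis
    unfolding rooted_iso_def using 1 2
    by (intro exI[of _ "f' \<circ> f"] exI[of _ "g' \<circ> g"]) (auto intro: bij_betw_trans)
qed

text \<open>The inverse of \<open>f\<close> undoes \<open>f\<close> only on \<open>V\<close>, so the
  endpoints of all edges must be vertices.\<close>

lemma rooted_iso_sym:
  assumes "rooted_iso d V E t h r V' E' t' h' r'" "wf_rooted V E t h r"
  shows "rooted_iso d V' E' t' h' r' V E t h r"
proof -
  obtain f g where 1: "bij_betw f V V'" "bij_betw g E E'" "f r = r'"
    "\<And>e. e \<in> E \<Longrightarrow> same_ends d (f (t e)) (f (h e)) (t' (g e)) (h' (g e))"
    using assms(1) unfolding rooted_iso_def by blast
  let ?f = "inv_into V f" and ?g = "inv_into E g"
  have inv: "?f (f x) = x" if "x \<in> V" for x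
    using that 1(1) by (simp add: bij_betw_def)
  have "same_ends d (?f (t' e)) (?f (h' e)) (t (?g e)) (h (?g e))" if "e \<in> E'" for e
  proof -
    have e: "?g e \<in> E" "g (?g e) = e"
      using that 1(2) by (auto simp: bij_betw_def inv_into_into f_inv_into_f)
    have "same_ends d (?f (f (t (?g e)))) (?f (f (h (?g e)))) (?f (t' (g (?g e)))) (?f (h' (g (?g e))))"
      by (rule same_ends_image[OF 1(4)[OF e(1)]])
    then show ?thesis
      using e assms(2) by (auto simp: wf_rooted_def inv intro: same_ends_sym)
  qed
  then show ?thesis
    unfolding rooted_iso_def using 1 inv assms(2)
    by (intro exI[of _ ?f] exI[of _ ?g]) (auto simp: bij_betw_inv_into wf_rooted_def)
qed

text \<open>The degree is a sum over edges of the number of ends at the root, and an isomorphism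
  preserves this number edge by edge, even if it swaps the ends.\<close>

lemma rooted_iso_root_deg:
  assumes "rooted_iso d V E t h r V' E' t' h' r'" "wf_rooted V E t h r" "finite E"
  shows "root_deg E t h r = root_deg E' t' h' r'"
proof -
  obtain f g where 1: "bij_betw f V V'" "bij_betw g E E'" "f r = r'"
    "\<And>e. e \<in> E \<Longrightarrow> same_ends d (f (t e)) (f (h e)) (t' (g e)) (h' (g e))"
    using assms(1) unfolding rooted_iso_def by blast
  have fin: "finite E'" using 1(2) assms(3) bij_betw_finite by blast
  have sum: "root_deg E t h r = (\<Sum>e\<in>E. (if t e = r then 1 else 0) + (if h e = r then 1 else 0))"
    if "finite E" for E and t h :: "_ \<Rightarrow> 'z" and r
    using that by (simp add: root_deg_def sum.distrib sum.If_cases Int_def)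
  have eq: "(if t e = r then 1 else 0) + (if h e = r then 1 else 0 :: nat)
    = (if t' (g e) = r' then 1 else 0) + (if h' (g e) = r' then 1 else 0)" if "e \<in> E" for e
  proof -
    have "t e = r \<longleftrightarrow> f (t e) = r'" "h e = r \<longleftrightarrow> f (h e) = r'"
      using assms(2) that 1(1,3) by (auto simp: wf_rooted_def bij_betw_def inj_on_def)
    then show ?thesis
      using same_ends_count[OF 1(4)[OF that], of r'] by simp
  qed
  have "root_deg E t h r = (\<Sum>e\<in>E. (if t' (g e) = r' then 1 else 0) + (if h' (g e) = r' then 1 else 0))"
    unfolding sum[OF assms(3)] by (rule sum.cong[OF refl eq])
  also have "\<dots> = (\<Sum>e\<in>E'. (if t' e = r' then 1 else 0) + (if h' e = r' then 1 else 0))"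
    by (rule sum.reindex_bij_betw[OF 1(2)])
  finally show ?thesis by (simp add: sum[OF fin])
qed

text \<open>A rooted graph code \<open>(a, b, t, h, o)\<close> has vertices \<open>{..<a}\<close> and edges \<open>{..<b}\<close>.\<close>

definition graph_codes :: "nat \<Rightarrow> nat \<Rightarrow> (nat \<times> nat \<times> (nat \<Rightarrow> nat) \<times> (nat \<Rightarrow> nat) \<times> nat) set" where
  "graph_codes A B = (SIGMA a:{..A}. SIGMA b:{..B}. ({..<b} \<rightarrow>\<^sub>E {..<a}) \<times> ({..<b} \<rightarrow>\<^sub>E {..<a}) \<times> {..<a})"

lemma finite_graph_codes: "finite (graph_codes A B)"
  unfolding graph_codes_def by (intro finite_SigmaI finite_cartesian_product finite_PiE) auto

lemma exists_graph_code:
  assumes "wf_rooted V E t h r" "finite V" "finite E" "card V \<le> A" "card E \<le> B"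
  obtains a b t' h' r' where "(a, b, t', h', r') \<in> graph_codes A B"
    "rooted_iso d V E t h r {..<a} {..<b} t' h' r'"
proof -
  obtain f where f: "bij_betw f V {..<card V}"
    using ex_bij_betw_finite_nat[OF assms(2)] by (auto simp: atLeast0LessThan)
  obtain g where g: "bij_betw g E {..<card E}"
    using ex_bij_betw_finite_nat[OF assms(3)] by (auto simp: atLeast0LessThan)
  let ?t = "\<lambda>e\<in>{..<card E}. f (t (inv_into E g e))" and ?h = "\<lambda>e\<in>{..<card E}. f (h (inv_into E g e))"
  have e: "inv_into E g e \<in> E" if "e < card E" for e
    using that g by (auto simp: bij_betw_def intro: inv_into_into)
  have fV: "f x < card V" if "x \<in> V" for x using that f by (auto simp: bij_betw_def)
  have code: "(card V, card E, ?t, ?h, f r) \<in> graph_codes A B"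
    using assms e fV by (auto simp: graph_codes_def wf_rooted_def)
  have "inv_into E g (g x) = x" "g x < card E" if "x \<in> E" for x
    using that g by (auto simp: bij_betw_def)
  then have iso: "rooted_iso True V E t h r {..<card V} {..<card E} ?t ?h (f r)"
    unfolding rooted_iso_def same_ends_def using f g by (intro exI[of _ f] exI[of _ g]) auto
  show ?thesis by (rule that[OF code rooted_iso_dir_imp[OF iso]])
qed

text \<open>Meant for the logarithms of \<open>p(n+1)/p(n)\<close>, whose partial sums telescope to
  \<open>ln p(n)\<close> up to a constant.\<close>

lemma cesaro_mean:
  fixes a :: "nat \<Rightarrow> real"
  assumes "a \<longlonglongrightarrow> l"
  shows "(\<lambda>n. (\<Sum>i<n. a i) / n) \<longlonglongrightarrow> l"
proof (rule LIMSEQ_I)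
  fix e :: real assume e: "0 < e"
  obtain N where N: "\<And>n. n \<ge> N \<Longrightarrow> \<bar>a n - l\<bar> < e / 2"
    using LIMSEQ_D[OF assms, of "e / 2"] e by auto
  define S where "S = (\<Sum>i<N. \<bar>a i - l\<bar>)"
  \<comment> \<open>Beyond \<open>M\<close> the fixed sum \<open>S\<close> over the first
    \<open>N\<close> terms is absorbed by \<open>n e / 2\<close>; the remaining terms are below
    \<open>e / 2\<close> each.\<close>
  obtain M where M: "S / (e / 2) < real M" using reals_Archimedean2 by blast
  have "norm ((\<Sum>i<n. a i) / n - l) < e" if n: "n \<ge> max (Suc N) M" for n
  proof -
    have pos: "0 < real n" using n by simp
    have "\<bar>(\<Sum>i<n. a i) - n * l\<bar> = \<bar>\<Sum>i<n. (a i - l)\<bar>" by (simp add: sum_subtractf)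
    also have "\<dots> \<le> (\<Sum>i<n. \<bar>a i - l\<bar>)" by (rule sum_abs)
    also have "\<dots> = S + (\<Sum>i\<in>{N..<n}. \<bar>a i - l\<bar>)"
    proof -
      have "{..<n} = {..<N} \<union> {N..<n}" using n by auto
      then show ?thesis unfolding S_def by (simp add: sum.union_disjoint ivl_disj_int)
    qed
    also have "(\<Sum>i\<in>{N..<n}. \<bar>a i - l\<bar>) \<le> (\<Sum>i\<in>{N..<n}. e / 2)"
      using N by (intro sum_mono) (auto intro: less_imp_le)
    also have "\<dots> \<le> n * (e / 2)" using e by (simp add: mult_right_mono)
    also have "S < M * (e / 2)" using M e by (simp add: field_simps)
    also have "M * (e / 2) \<le> n * (e / 2)" using n e by (intro mult_right_mono) auto
    finally have *: "\<bar>(\<Sum>i<n. a i) - n * l\<bar> < n * e" by (simp add: mult.commute)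
    have "(\<Sum>i<n. a i) / n - l = ((\<Sum>i<n. a i) - n * l) / n"
      using pos by (simp add: field_simps)
    then show ?thesis using * pos by (simp add: field_simps)
  qed
  then show "\<exists>no. \<forall>n\<ge>no. norm ((\<Sum>i<n. a i) / n - l) < e" by blast
qed

section \<open>Balls in Rauzy graphs\<close>

context factorial_language
begin

abbreviation "BV n \<equiv> ball_verts (rauzy_verts L n) (rauzy_arcs L n) rauzy_tail rauzy_head"
abbreviation "BE n \<equiv> ball_edges (rauzy_verts L n) (rauzy_arcs L n) rauzy_tail rauzy_head"

lemma ball_freq_eq:
  "ball_freq d L n r VH EH tH hH oH =
     real (card {v \<in> lang_n L n. rooted_iso d (BV n v r) (BE n v r) rauzy_tail rauzy_head v VH EH tH hH oH})
     / real (complexity L n)"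
  unfolding ball_freq_def Let_def rooted_iso_def same_ends_def rooted_iso_dir_def rooted_iso_undir_def
    complexity_def rauzy_verts_def
  by (cases d) simp_all

lemma ball_verts_subset: "v \<in> lang_n L n \<Longrightarrow> BV n v r \<subseteq> lang_n L n"
  by (induction r) (auto simp: rauzy_verts_def)

lemma root_in_ball: "v \<in> BV n v r"
  by (induction r) auto

lemma wf_ball: "wf_rooted (BV n v r) (BE n v r) rauzy_tail rauzy_head v"
  using root_in_ball by (auto simp: wf_rooted_def ball_edges_def)

lemma finite_ball:
  assumes "v \<in> lang_n L n"
  shows "finite (BV n v r)" "finite (BE n v r)"
  using ball_verts_subset[OF assms, of r] finite_subset finite_lang_n
  by (blast, auto simp: ball_edges_def)

text \<open>Every arc at \<open>v\<close>, loops included, has both ends in the ball of radius 1, so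
  the degree is visible locally.\<close>

lemma root_deg_ball_1:
  assumes "v \<in> lang_n L n"
  shows "root_deg (BE n v 1) rauzy_tail rauzy_head v = out_deg L v + in_deg L v"
proof -
  have "e \<in> BE n v 1" if "e \<in> rauzy_arcs L n" "butlast e = v \<or> tl e = v" for e
    using that tl_butlast_lang_n[of e n]
    by (auto simp: ball_edges_def rauzy_tail_def rauzy_head_def rauzy_arcs_eq rauzy_verts_def adjacent_def)
  then have "{e \<in> BE n v 1. rauzy_tail e = v} = {e \<in> rauzy_arcs L n. butlast e = v}"
    "{e \<in> BE n v 1. rauzy_head e = v} = {e \<in> rauzy_arcs L n. tl e = v}"
    by (auto simp: ball_edges_def rauzy_tail_def rauzy_head_def)
  then show ?thesis
    unfolding root_deg_def using card_out_arcs[OF assms] card_in_arcs[OF assms] by simp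
qed

declare ball_verts.simps(2) [simp del]

text \<open>Neighbours are obtained by sliding the window by one letter, and an arc is its tail plus
  one letter. Since the bounds do not depend on \<open>n\<close>, only finitely many 1-balls occur
  up to isomorphism.\<close>

lemma card_ball_1_le:
  assumes "v \<in> lang_n L n"
  shows "card (BV n v 1) \<le> 1 + 2 * CARD('a)" "card (BE n v 1) \<le> (1 + 2 * CARD('a)) * CARD('a)"
proof -
  let ?S = "(\<lambda>b. tl (v @ [b])) ` UNIV" and ?P = "(\<lambda>a. butlast (a # v)) ` UNIV"
  have "y \<in> ?S \<union> ?P" if adj: "adjacent (rauzy_arcs L n) rauzy_tail rauzy_head v y" for y
  proof -
    obtain e where e: "e \<in> lang_n L (Suc n)" "(butlast e = v \<and> tl e = y) \<or> (butlast e = y \<and> tl e = v)"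
      using adj unfolding adjacent_def rauzy_arcs_eq rauzy_tail_def rauzy_head_def by blast
    have "e \<noteq> []" using e by (auto simp: lang_n_def)
    then have "butlast e = v \<Longrightarrow> v @ [last e] = e" "tl e = v \<Longrightarrow> hd e # v = e" by auto
    then have "y = tl (v @ [last e]) \<or> y = butlast (hd e # v)" using e(2) by metis
    then show ?thesis by blast
  qed
  moreover have "BV n v 1 \<subseteq> {v} \<union> {y. adjacent (rauzy_arcs L n) rauzy_tail rauzy_head v y}"
    by (auto simp: ball_verts.simps(2))
  ultimately have "BV n v 1 \<subseteq> {v} \<union> (?S \<union> ?P)" by blast
  then have "card (BV n v 1) \<le> card ({v} \<union> (?S \<union> ?P))" by (intro card_mono) auto
  also have "\<dots> \<le> card {v} + (card ?S + card ?P)"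
    by (meson add_left_mono card_Un_le le_trans)
  also have "\<dots> \<le> 1 + (CARD('a) + CARD('a))"
    by (intro add_mono card_image_le) auto
  finally show *: "card (BV n v 1) \<le> 1 + 2 * CARD('a)" by simp
  let ?f = "\<lambda>(x, b :: 'a). x @ [b]"
  have "BE n v 1 \<subseteq> ?f ` (BV n v 1 \<times> UNIV)"
  proof
    fix e assume e: "e \<in> BE n v 1"
    then have "e \<noteq> []" by (auto simp: ball_edges_def rauzy_arcs_eq lang_n_def)
    then have "e = ?f (butlast e, last e)" by simp
    moreover have "butlast e \<in> BV n v 1" using e by (simp add: ball_edges_def rauzy_tail_def)
    ultimately show "e \<in> ?f ` (BV n v 1 \<times> UNIV)" by blast
  qed
  then have "card (BE n v 1) \<le> card (?f ` (BV n v 1 \<times> UNIV))"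
    using finite_ball[OF assms] by (intro card_mono) auto
  also have "\<dots> \<le> card (BV n v 1 \<times> (UNIV :: 'a set))"
    using finite_ball[OF assms] by (intro card_image_le) auto
  also have "\<dots> \<le> (1 + 2 * CARD('a)) * CARD('a)"
    unfolding card_cartesian_product by (rule mult_right_mono[OF *]) simp
  finally show "card (BE n v 1) \<le> (1 + 2 * CARD('a)) * CARD('a)" .
qed

lemma sum_deg: "(\<Sum>v\<in>lang_n L n. out_deg L v + in_deg L v) = 2 * complexity L (Suc n)"
  by (simp add: sum.distrib sum_out_deg sum_in_deg)

end

section \<open>Degrees and growth\<close>

lemma LIMSEQ_squeeze:
  fixes f g h :: "nat \<Rightarrow> real"
  assumes "\<And>n. f n \<le> g n" "\<And>n. g n \<le> h n" "f \<longlonglongrightarrow> c" "h \<longlonglongrightarrow> c"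
  shows "g \<longlonglongrightarrow> c"
  using assms by (intro real_tendsto_sandwich[of f g sequentially h c] always_eventually) auto

context almost_prolongable_language
begin

abbreviation "ratio \<equiv> \<lambda>n. real (complexity L (n + 1)) / real (complexity L n)"

lemma ball_freq_bounds: "0 \<le> ball_freq d L n r VH EH tH hH oH" "ball_freq d L n r VH EH tH hH oH \<le> 1"
proof -
  show "0 \<le> ball_freq d L n r VH EH tH hH oH" by (simp add: ball_freq_eq)
  have "card {v \<in> lang_n L n. rooted_iso d (BV n v r) (BE n v r) rauzy_tail rauzy_head v VH EH tH hH oH}
     \<le> complexity L n" unfolding complexity_def by (intro card_mono) auto
  then show "ball_freq d L n r VH EH tH hH oH \<le> 1"
    using complexity_pos[of n] by (simp add: ball_freq_eq)
qed

text \<open>A vertex whose 1-ball is that of the line has two arc ends at it, and all others have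
  bounded degree, so the mean degree differs from 2 by at most a constant times the frequency of the
  others. Only degrees counted without orientation enter, so \<open>d\<close> is arbitrary.\<close>

lemma line_imp_ratio:
  assumes "BS_converges_to_line d L"
  shows "ratio \<longlonglongrightarrow> 1"
proof -
  let ?k = "real (2 * CARD('a) + 2)"
  let ?F = "\<lambda>n. ball_freq d L n 1 {-1..1} {-1..<1} (\<lambda>i :: int. i) (\<lambda>i. i + 1) 0"
  have F: "?F \<longlonglongrightarrow> 1" using assms by (auto simp: BS_converges_to_line_def dest!: spec[of _ 1])
  have bound: "\<bar>ratio n - 1\<bar> \<le> ?k * (1 - ?F n)" for n
  proof -
    define S where "S = {v \<in> lang_n L n. rooted_iso d (BV n v 1) (BE n v 1) rauzy_tail rauzy_head v
        {-1..1} {-1..<1} (\<lambda>i :: int. i) (\<lambda>i. i + 1) 0}"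
    define D where "D v = real (out_deg L v + in_deg L v)" for v
    have p: "0 < real (complexity L n)" using complexity_pos by simp
    have S: "S \<subseteq> lang_n L n" by (auto simp: S_def)
    have D2: "D v = 2" if "v \<in> S" for v
    proof -
      have "{e \<in> {-1..<1}. e = (0 :: int)} = {0}" "{e \<in> {-1..<1}. e + 1 = (0 :: int)} = {-1}" by auto
      then have "root_deg {-1..<1} (\<lambda>i :: int. i) (\<lambda>i. i + 1) 0 = 2" by (simp add: root_deg_def)
      moreover have "root_deg (BE n v 1) rauzy_tail rauzy_head v = root_deg {-1..<1} (\<lambda>i :: int. i) (\<lambda>i. i + 1) 0"
        using that finite_ball(2) wf_ball by (intro rooted_iso_root_deg) (auto simp: S_def)
      ultimately show ?thesis using root_deg_ball_1[of v n] that S by (auto simp: D_def)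
    qed
    have "\<bar>(\<Sum>v\<in>lang_n L n. D v - 2)\<bar> = \<bar>\<Sum>v\<in>lang_n L n - S. D v - 2\<bar>"
      by (subst sum.subset_diff[OF S]) (simp_all add: D2)
    also have "\<dots> \<le> (\<Sum>v\<in>lang_n L n - S. \<bar>D v - 2\<bar>)" by (rule sum_abs)
    also have "\<dots> \<le> (\<Sum>v\<in>lang_n L n - S. ?k)"
    proof (rule sum_mono)
      fix v
      have "real (out_deg L v) \<le> CARD('a)" "real (in_deg L v) \<le> CARD('a)"
        using deg_le_card[of L v] by simp_all
      then show "\<bar>D v - 2\<bar> \<le> ?k" by (simp add: D_def)
    qed
    also have "\<dots> = ?k * (real (complexity L n) - card S)"
      using S by (simp add: card_Diff_subset finite_subset[OF S] complexity_def card_mono of_nat_diff algebra_simps)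
    finally have le: "\<bar>(\<Sum>v\<in>lang_n L n. D v - 2)\<bar> \<le> ?k * (real (complexity L n) - card S)" .
    have sum: "(\<Sum>v\<in>lang_n L n. D v - 2) = 2 * (real (complexity L (Suc n)) - real (complexity L n))"
    proof -
      have "(\<Sum>v\<in>lang_n L n. D v) = 2 * real (complexity L (Suc n))"
        unfolding D_def of_nat_sum[symmetric] sum_deg by simp
      then show ?thesis by (simp add: sum_subtractf complexity_def)
    qed
    have "\<bar>real (complexity L (Suc n)) - real (complexity L n)\<bar> \<le> ?k * (real (complexity L n) - card S)"
      by (rule order_trans[OF _ le[unfolded sum]]) simp
    then have "\<bar>real (complexity L (Suc n)) - real (complexity L n)\<bar> / complexity L n
        \<le> ?k * (real (complexity L n) - card S) / complexity L n"
      using p by (intro divide_right_mono) auto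
    moreover have "\<bar>ratio n - 1\<bar> = \<bar>real (complexity L (Suc n)) - real (complexity L n)\<bar> / complexity L n"
    proof -
      have "ratio n - 1 = (real (complexity L (Suc n)) - real (complexity L n)) / complexity L n"
        using p by (simp add: diff_divide_distrib)
      then show ?thesis by (simp add: abs_divide)
    qed
    moreover have "?k * (real (complexity L n) - card S) / complexity L n = ?k * (1 - ?F n)"
    proof -
      have "?F n = card S / complexity L n" by (simp add: ball_freq_eq S_def)
      then have "1 - ?F n = (real (complexity L n) - card S) / complexity L n"
        using p by (simp add: diff_divide_distrib)
      then show ?thesis by (simp only: times_divide_eq_right)
    qed
    ultimately show ?thesis by (simp only:)
  qed
  have "(\<lambda>n. ?k * (1 - ?F n)) \<longlonglongrightarrow> ?k * (1 - 1)" by (intro tendsto_intros F)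
  then have "(\<lambda>n. \<bar>ratio n - 1\<bar>) \<longlonglongrightarrow> 0"
    by (intro LIMSEQ_squeeze[OF _ bound tendsto_const]) simp_all
  then show ?thesis by (simp only: tendsto_rabs_zero_iff LIM_zero_iff)
qed

text \<open>The mean degree is a finite combination of frequencies of 1-balls: every vertex is counted once
  for each code isomorphic to its ball, and the number of such codes depends only on the code.\<close>

lemma BS_limit_imp_convergent_ratio:
  assumes "BS_limit_exists d L"
  shows "convergent ratio"
proof -
  let ?A = "1 + 2 * CARD('a)" and ?B = "(1 + 2 * CARD('a)) * CARD('a)"
  define C where "C = graph_codes ?A ?B"
  define I where "I n v = (\<lambda>(a, b, t, h, r). rooted_iso d (BV n v 1) (BE n v 1) rauzy_tail rauzy_head v {..<a :: nat} {..<b :: nat} t h r)"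
    for n v
  \<comment> \<open>Isomorphism between codes. By symmetry and transitivity the codes of a given
    ball form one such class, so the weight \<open>w c\<close> divides the degree by the size of the
    class of \<open>c\<close>, and the contributions of one vertex add up to its degree.\<close>
  define J where "J = (\<lambda>(a, b, t, h, r) (a', b', t', h', r').
    rooted_iso d {..<a :: nat} {..<b :: nat} t h r {..<a' :: nat} {..<b' :: nat} t' h' r')"
  define w where "w c = (case c of (a, b, t, h, r) \<Rightarrow> real (root_deg {..<b} t h r)) / card {c' \<in> C. J c c'}"
    for c :: "nat \<times> nat \<times> (nat \<Rightarrow> nat) \<times> (nat \<Rightarrow> nat) \<times> nat"
  define F where "F c n = real (card {v \<in> lang_n L n. I n v c}) / complexity L n" for c n
  have finC: "finite C" by (simp add: C_def finite_graph_codes)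
  have IJ: "I n v c' \<longleftrightarrow> J c c'" if "I n v c" for n v c c'
  proof -
    obtain a b t h r where c: "c = (a, b, t, h, r)" by (cases c)
    obtain a' b' t' h' r' where c': "c' = (a', b', t', h', r')" by (cases c')
    have iso: "rooted_iso d (BV n v 1) (BE n v 1) rauzy_tail rauzy_head v {..<a} {..<b} t h r"
      using that unfolding I_def c by (simp only: prod.case)
    show ?thesis
      unfolding I_def J_def c c' prod.case
      using rooted_iso_trans[OF rooted_iso_sym[OF iso wf_ball]] rooted_iso_trans[OF iso] by (rule iffI)
  qed
  have ex: "\<exists>c\<in>C. I n v c" if v: "v \<in> lang_n L n" for n v
  proof -
    obtain a b t h r where "(a, b, t, h, r) \<in> C"
      "rooted_iso d (BV n v 1) (BE n v 1) rauzy_tail rauzy_head v {..<a} {..<b} t h r"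
      unfolding C_def by (rule exists_graph_code[OF wf_ball finite_ball[OF v] card_ball_1_le[OF v]])
    then show ?thesis by (intro bexI[of _ "(a, b, t, h, r)"]) (simp_all add: I_def)
  qed
  have deg: "real (out_deg L v + in_deg L v) = (\<Sum>c\<in>C. w c * (if I n v c then 1 else 0))"
    if v: "v \<in> lang_n L n" for n v
  proof -
    let ?N = "card {c' \<in> C. I n v c'}"
    have "{c' \<in> C. I n v c'} \<noteq> {}" using ex[OF v] by blast
    then have N: "0 < ?N" using finC by (simp only: card_gt_0_iff) simp
    have wI: "w c = real (out_deg L v + in_deg L v) / ?N" if "I n v c" for c
    proof -
      obtain a b t h r where c: "c = (a, b, t, h, r)" by (cases c)
      have "root_deg (BE n v 1) rauzy_tail rauzy_head v = root_deg {..<b} t h r"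
        using that finite_ball[OF v] wf_ball by (intro rooted_iso_root_deg[of d]) (auto simp: I_def c)
      then show ?thesis using root_deg_ball_1[OF v] IJ[OF that] by (simp add: w_def c)
    qed
    have "(\<Sum>c\<in>C. w c * (if I n v c then 1 else 0))
        = (\<Sum>c\<in>C. if I n v c then real (out_deg L v + in_deg L v) / ?N else 0)"
      by (intro sum.cong) (auto simp: wI)
    also have "\<dots> = real ?N * (real (out_deg L v + in_deg L v) / ?N)"
      by (simp only: sum.inter_filter[OF finC, symmetric] sum_constant)
    also have "\<dots> = real (out_deg L v + in_deg L v)"
    proof -
      have "real N * (x / real N) = x" if "0 < N" for N :: nat and x using that by simp
      from this[OF N] show ?thesis .
    qed
    finally show ?thesis by simp
  qed
  have eq: "ratio n = (\<Sum>c\<in>C. w c * F c n) / 2" for n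
  proof -
    have "2 * real (complexity L (Suc n)) = (\<Sum>v\<in>lang_n L n. real (out_deg L v + in_deg L v))"
      unfolding of_nat_sum[symmetric] sum_deg by simp
    also have "\<dots> = (\<Sum>v\<in>lang_n L n. \<Sum>c\<in>C. w c * (if I n v c then 1 else 0))"
      by (intro sum.cong deg) auto
    also have "\<dots> = (\<Sum>c\<in>C. \<Sum>v\<in>lang_n L n. w c * (if I n v c then 1 else 0))"
      by (rule sum.swap)
    also have "\<dots> = (\<Sum>c\<in>C. w c * card {v \<in> lang_n L n. I n v c})"
      by (simp add: sum_distrib_left[symmetric] sum.If_cases Int_def)
    finally have "2 * real (complexity L (Suc n)) = (\<Sum>c\<in>C. w c * card {v \<in> lang_n L n. I n v c})" .
    moreover have "(\<Sum>c\<in>C. w c * F c n) = (\<Sum>c\<in>C. w c * card {v \<in> lang_n L n. I n v c}) / complexity L n"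
      by (simp add: F_def sum_divide_distrib)
    ultimately have "(\<Sum>c\<in>C. w c * F c n) = 2 * real (complexity L (Suc n)) / complexity L n" by simp
    then show ?thesis by simp
  qed
  have conv: "convergent (F c)" for c
  proof -
    obtain a b t h r where c: "c = (a, b, t, h, r)" by (cases c)
    have "convergent (\<lambda>n. ball_freq d L n 1 {..<a} {..<b} t h r)"
      using assms unfolding BS_limit_exists_def by blast
    then show ?thesis by (simp add: F_def[abs_def] c I_def ball_freq_eq)
  qed
  then have "F c \<longlonglongrightarrow> lim (F c)" for c by (simp add: convergent_LIMSEQ_iff)
  then have "(\<lambda>n. (\<Sum>c\<in>C. w c * F c n) / 2) \<longlonglongrightarrow> (\<Sum>c\<in>C. w c * lim (F c)) / 2"
    by (intro tendsto_intros) auto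
  then show ?thesis unfolding eq[abs_def] by (rule convergentI)
qed

text \<open>A Cesaro mean of the telescoping terms \<open>ln (p(n+1)/p(n))\<close>; positivity of
  \<open>l\<close> keeps the logarithm continuous at the limit.\<close>

lemma ln_complexity_mean:
  assumes "ratio \<longlonglongrightarrow> l" "0 < l"
  shows "(\<lambda>n. ln (real (complexity L n)) / n) \<longlonglongrightarrow> ln l"
proof -
  have "(\<lambda>n. ln (ratio n)) \<longlonglongrightarrow> ln l" using assms by (intro tendsto_ln) auto
  then have "(\<lambda>n. (\<Sum>i<n. ln (ratio i)) / n) \<longlonglongrightarrow> ln l" by (rule cesaro_mean)
  moreover have "(\<Sum>i<n. ln (ratio i)) = ln (complexity L n) - ln (complexity L 0)" for n
    using complexity_pos by (induction n) (auto simp: ln_div)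
  ultimately have *: "(\<lambda>n. ln (real (complexity L n)) / n - ln (complexity L 0) / n) \<longlonglongrightarrow> ln l"
    by (simp add: diff_divide_distrib)
  have "(\<lambda>n. ln (complexity L 0) / real n) \<longlonglongrightarrow> 0" by (rule lim_const_over_n)
  from tendsto_add[OF * this] show ?thesis by simp
qed

lemma ratio_1_imp_subexponential: "ratio \<longlonglongrightarrow> 1 \<Longrightarrow> subexponential (complexity L)"
  using ln_complexity_mean[of 1] by (simp add: subexponential_def)

text \<open>Right-prolongable words have density tending to 1 and number at most
  \<open>p(n+1)\<close>, so the limit is at least 1; its logarithm is the growth rate, which is
  0.\<close>

lemma convergent_ratio_imp_1:
  assumes "convergent ratio" "subexponential (complexity L)"
  shows "ratio \<longlonglongrightarrow> 1"
proof -
  obtain l where l: "ratio \<longlonglongrightarrow> l" using assms(1) by (auto simp: convergent_def)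
  have "1 \<le> l"
  proof (rule LIMSEQ_le[OF right_prolongable_ratio l])
    show "\<exists>N. \<forall>n\<ge>N. real (card {v \<in> lang_n L n. right_prolongable L v}) / real (complexity L n) \<le> ratio n"
      using card_right_prolongable_le by (auto intro!: divide_right_mono)
  qed
  then have "ln l = 0"
    using LIMSEQ_unique ln_complexity_mean[OF l] assms(2) unfolding subexponential_def by force
  then show ?thesis using l \<open>1 \<le> l\<close> by simp
qed

text \<open>The limit is a point mass: the frequency of a finite graph tends to 1 if it is
  isomorphic to the \<open>r\<close>-ball of the line, and to 0 otherwise, because then no vertex
  can be counted for both.\<close>

lemma line_imp_BS_limit:
  assumes line: "BS_converges_to_line d L"
  shows "BS_limit_exists d L"
  unfolding BS_limit_exists_def
proof (intro allI impI)
  fix r :: nat and VH EH :: "nat set" and tH hH oH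
  let ?iso = "\<lambda>n v. rooted_iso d (BV n v r) (BE n v r) rauzy_tail rauzy_head v"
  let ?line = "\<lambda>n. ball_freq d L n r {-int r..int r} {-int r..<int r} (\<lambda>i. i) (\<lambda>i. i + 1) 0"
  have lim: "?line \<longlonglongrightarrow> 1" using line by (simp add: BS_converges_to_line_def)
  have wf: "wf_rooted {-int r..int r} {-int r..<int r} (\<lambda>i. i) (\<lambda>i. i + 1) 0"
    by (auto simp: wf_rooted_def)
  show "convergent (\<lambda>n. ball_freq d L n r VH EH tH hH oH)"
  proof (cases "rooted_iso d {-int r..int r} {-int r..<int r} (\<lambda>i. i) (\<lambda>i. i + 1) 0 VH EH tH hH oH")
    case True
    have "?iso n v VH EH tH hH oH \<longleftrightarrow> ?iso n v {-int r..int r} {-int r..<int r} (\<lambda>i. i) (\<lambda>i. i + 1) 0" for n v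
      using rooted_iso_trans[OF _ rooted_iso_sym[OF True wf]] rooted_iso_trans[OF _ True] by (rule iffI)
    then have "(\<lambda>n. ball_freq d L n r VH EH tH hH oH) = ?line" by (simp add: ball_freq_eq)
    then show ?thesis using lim by (auto intro: convergentI)
  next
    case False
    have le: "ball_freq d L n r VH EH tH hH oH \<le> 1 - ?line n" for n
    proof -
      let ?S = "{v \<in> lang_n L n. ?iso n v VH EH tH hH oH}"
      let ?T = "{v \<in> lang_n L n. ?iso n v {-int r..int r} {-int r..<int r} (\<lambda>i. i) (\<lambda>i. i + 1) 0}"
      have "?S \<inter> ?T = {}"
      proof (intro equalityI subsetI)
        fix v assume "v \<in> ?S \<inter> ?T"
        then have "?iso n v VH EH tH hH oH" "?iso n v {-int r..int r} {-int r..<int r} (\<lambda>i. i) (\<lambda>i. i + 1) 0"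
          by auto
        from rooted_iso_trans[OF rooted_iso_sym[OF this(2) wf_ball] this(1)] False show "v \<in> {}" by simp
      qed simp
      then have "card ?S + card ?T = card (?S \<union> ?T)" by (intro card_Un_disjoint[symmetric]) auto
      also have "\<dots> \<le> complexity L n" unfolding complexity_def by (intro card_mono) auto
      finally have "real (card ?S) + real (card ?T) \<le> complexity L n" by linarith
      then show ?thesis using complexity_pos[of n] by (simp add: ball_freq_eq field_simps)
    qed
    have "(\<lambda>n. 1 - ?line n) \<longlonglongrightarrow> 0" using tendsto_diff[OF tendsto_const lim, of 1] by simp
    then have "(\<lambda>n. ball_freq d L n r VH EH tH hH oH) \<longlonglongrightarrow> 0"
      by (rule LIMSEQ_squeeze[OF ball_freq_bounds(1) le tendsto_const])
    then show ?thesis by (rule convergentI)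
  qed
qed

lemma directed_line_imp_undirected_line:
  assumes "BS_converges_to_line True L"
  shows "BS_converges_to_line False L"
  unfolding BS_converges_to_line_def
proof
  fix r :: nat
  let ?f = "\<lambda>d n. ball_freq d L n r {-int r..int r} {-int r..<int r} (\<lambda>i. i) (\<lambda>i. i + 1) 0"
  have "?f True n \<le> ?f False n" for n
    unfolding ball_freq_eq
    by (intro divide_right_mono of_nat_mono card_mono) (auto intro: rooted_iso_dir_imp)
  moreover have "?f True \<longlonglongrightarrow> 1" using assms by (simp add: BS_converges_to_line_def)
  ultimately show "?f False \<longlonglongrightarrow> 1"
    by (rule LIMSEQ_squeeze[OF _ ball_freq_bounds(2) _ tendsto_const])
qed

end

section \<open>Lines in Rauzy graphs\<close>

definition word_path :: "'a list set \<Rightarrow> 'a list \<Rightarrow> int \<Rightarrow> 'a list" where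
  "word_path L v i = (if 0 \<le> i then (word_succ L ^^ nat i) v else (word_pred L ^^ nat (- i)) v)"

text \<open>The entry \<open>(u, v)\<close> of \<open>C\<^sub>m(A)\<close> for the adjacency
  operator \<open>A\<close>, indexed by words so that the combinatorics is independent of an
  enumeration of the vertices. The start value 2 is what makes the recurrence produce
  \<open>S\<^sup>m + S\<^sup>-\<^sup>m\<close> on a path.\<close>

fun cheb_entry :: "'a list set \<Rightarrow> nat \<Rightarrow> nat \<Rightarrow> 'a list \<Rightarrow> 'a list \<Rightarrow> real" where
  "cheb_entry L n 0 u v = 2 * of_bool (u = v)"
| "cheb_entry L n (Suc 0) u v = rauzy_adj L n u v"
| "cheb_entry L n (Suc (Suc m)) u v =
     (\<Sum>x\<in>lang_n L n. real (rauzy_adj L n u x) * cheb_entry L n (Suc m) x v) - cheb_entry L n m u v"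

lemma sum_of_bool_mult:
  fixes f :: "'b \<Rightarrow> real"
  assumes "finite A" "p \<in> A" "q \<in> A"
  shows "(\<Sum>x\<in>A. (of_bool (x = p) + of_bool (x = q)) * f x) = f p + f q"
  using assms by (simp add: distrib_right sum.distrib of_bool_def if_distrib[of "\<lambda>c. c * _"] cong: if_cong)

context factorial_language
begin

lemma regular_arcs:
  assumes "x \<in> regular_words L M n" "0 < n"
  shows "{w \<in> rauzy_arcs L n. butlast w = x} = {x @ [last (word_succ L x)]}"
    "tl (x @ [last (word_succ L x)]) = word_succ L x"
    "{w \<in> rauzy_arcs L n. tl w = x} = {hd (word_pred L x) # x}"
    "butlast (hd (word_pred L x) # x) = word_pred L x"
proof -
  have ne: "x \<noteq> []" using assms by (auto simp: regular_words_def lang_n_def)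
  obtain b where b: "word_succ L x = tl x @ [b]" "{w \<in> rauzy_arcs L n. butlast w = x} = {x @ [b]}"
    using regular_succ[OF assms] by metis
  then show "{w \<in> rauzy_arcs L n. butlast w = x} = {x @ [last (word_succ L x)]}"
    "tl (x @ [last (word_succ L x)]) = word_succ L x" using ne by simp_all
  obtain a where a: "word_pred L x = a # butlast x" "{w \<in> rauzy_arcs L n. tl w = x} = {a # x}"
    using regular_pred[OF assms] by metis
  then show "{w \<in> rauzy_arcs L n. tl w = x} = {hd (word_pred L x) # x}"
    "butlast (hd (word_pred L x) # x) = word_pred L x" using ne by simp_all
qed

lemma regular_adjacent:
  assumes "x \<in> regular_words L M n" "0 < n"
  shows "adjacent (rauzy_arcs L n) rauzy_tail rauzy_head x y \<longleftrightarrow> y = word_succ L x \<or> y = word_pred L x"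
proof -
  have "adjacent (rauzy_arcs L n) rauzy_tail rauzy_head x y \<longleftrightarrow>
      (\<exists>e\<in>{w \<in> rauzy_arcs L n. butlast w = x}. tl e = y) \<or> (\<exists>e\<in>{w \<in> rauzy_arcs L n. tl w = x}. butlast e = y)"
    unfolding adjacent_def rauzy_tail_def rauzy_head_def by blast
  also have "\<dots> \<longleftrightarrow> word_succ L x = y \<or> word_pred L x = y"
    unfolding regular_arcs(1,3)[OF assms] using regular_arcs(2,4)[OF assms] by auto
  finally show ?thesis by auto
qed

lemma iterate_deep:
  "v \<in> deep_words L M n r \<Longrightarrow> j \<le> r \<Longrightarrow> (word_succ L ^^ j) v \<in> deep_words L M n (r - j)"
  "v \<in> deep_words L M n r \<Longrightarrow> j \<le> r \<Longrightarrow> (word_pred L ^^ j) v \<in> deep_words L M n (r - j)"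
proof (induction j)
  case (Suc j)
  {
    case 1
    then have "(word_succ L ^^ j) v \<in> deep_words L M n (Suc (r - Suc j))"
      using Suc.IH(1) by (simp add: Suc_diff_Suc)
    then show ?case by simp
  next
    case 2
    then have "(word_pred L ^^ j) v \<in> deep_words L M n (Suc (r - Suc j))"
      using Suc.IH(2) by (simp add: Suc_diff_Suc)
    then show ?case by simp
  }
qed simp_all

section \<open>The path through a deep word\<close>

context
  fixes v :: "'a list" and M n r :: nat
  assumes v: "v \<in> deep_words L M n r" and n: "0 < n"
begin

abbreviation "\<phi> \<equiv> word_path L v"

lemma path_0 [simp]: "\<phi> 0 = v"
  by (simp add: word_path_def)

lemma path_regular:
  assumes "- int r \<le> i" "i \<le> int r"
  shows "\<phi> i \<in> regular_words L M n"
proof (cases "0 \<le> i")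
  case True
  then have "\<phi> i \<in> deep_words L M n (r - nat i)"
    using iterate_deep(1)[OF v, of "nat i"] assms by (simp add: word_path_def)
  then show ?thesis using deep_words_subset(1) by blast
next
  case False
  then have "\<phi> i \<in> deep_words L M n (r - nat (- i))"
    using iterate_deep(2)[OF v, of "nat (- i)"] assms by (simp add: word_path_def)
  then show ?thesis using deep_words_subset(1) by blast
qed

lemma path_lang:
  assumes "- int r \<le> i" "i \<le> int r"
  shows "\<phi> i \<in> lang_n L n"
  using path_regular[OF assms] by (simp add: regular_words_def)

lemma path_succ:
  assumes "- int r \<le> i" "i < int r"
  shows "word_succ L (\<phi> i) = \<phi> (i + 1)"
proof (cases "0 \<le> i")
  case True
  then have "nat (i + 1) = Suc (nat i)" by simp
  then show ?thesis using True by (simp add: word_path_def)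
next
  case False
  then have "nat (- i) = Suc (nat (- (i + 1)))" by simp
  then have "\<phi> i = word_pred L (\<phi> (i + 1))"
    using False by (cases "i + 1 = 0") (simp_all add: word_path_def)
  then show ?thesis
    using succ_pred[of "\<phi> (i + 1)" M n] path_regular[of "i + 1"] path_regular[of i] assms n by simp
qed

lemma path_pred:
  assumes "- int r < i" "i \<le> int r"
  shows "word_pred L (\<phi> i) = \<phi> (i - 1)"
proof -
  have "\<phi> i = word_succ L (\<phi> (i - 1))" using path_succ[of "i - 1"] assms by simp
  then show ?thesis
    using pred_succ[of "\<phi> (i - 1)" M n] path_regular[of i] path_regular[of "i - 1"] assms n by simp
qed

text \<open>Each step drops the first letter, so the word reached after \<open>m\<close> steps shows
  the letters of the starting word from position \<open>m\<close> on.\<close>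

lemma path_nth:
  assumes "- int r \<le> i" "i + int m \<le> int r" "t + m < n"
  shows "\<phi> (i + int m) ! t = \<phi> i ! (t + m)"
  using assms(2,3)
proof (induction m arbitrary: t)
  case (Suc m)
  have reg: "\<phi> (i + int m) \<in> regular_words L M n"
    using assms(1) Suc.prems by (intro path_regular) auto
  obtain b where b: "word_succ L (\<phi> (i + int m)) = tl (\<phi> (i + int m)) @ [b]"
    using regular_succ[OF reg n] by metis
  have len: "length (\<phi> (i + int m)) = n" using reg by (simp add: regular_words_def lang_n_def)
  have "\<phi> (i + int (Suc m)) = word_succ L (\<phi> (i + int m))"
    using path_succ[of "i + int m"] assms(1) Suc.prems by (simp add: algebra_simps)
  then have "\<phi> (i + int (Suc m)) ! t = \<phi> (i + int m) ! Suc t"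
    using b len Suc.prems by (auto simp: nth_append nth_tl)
  also have "\<dots> = \<phi> i ! (Suc t + m)"
    using Suc.prems by (intro Suc.IH) auto
  finally show ?case by simp
qed simp

text \<open>Returning to the same window after \<open>m\<close> steps overlaps the word with its own
  shift by \<open>m\<close>, that is, makes it \<open>m\<close>-periodic, and regular words exclude
  all periods up to \<open>M\<close>.\<close>

lemma path_neq:
  assumes "- int r \<le> i" "i < j" "j \<le> int r" "j - i \<le> int M"
  shows "\<phi> i \<noteq> \<phi> j"
proof
  assume eq: "\<phi> i = \<phi> j"
  define m where "m = nat (j - i)"
  have m: "j = i + int m" "m \<in> {1..M}" using assms by (auto simp: m_def)
  have reg: "\<phi> i \<in> regular_words L M n" using assms by (intro path_regular) auto
  then have len: "length (\<phi> i) = n" by (simp add: regular_words_def lang_n_def)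
  have "word_periodic m (\<phi> i)"
    unfolding word_periodic_def len
  proof (intro allI impI)
    fix t assume "t + m < n"
    then show "\<phi> i ! (t + m) = \<phi> i ! t"
      using path_nth[of i m t] assms(1,3) m eq by simp
  qed
  then show False using reg m by (simp add: regular_words_def)
qed

text \<open>Two indices of the path differ by at most \<open>2 r\<close>, hence the condition on
  \<open>M\<close>.\<close>

lemma path_inj: "2 * r \<le> M \<Longrightarrow> inj_on \<phi> {-int r..int r}"
  using path_neq by (intro linorder_inj_onI) auto

lemma ball_verts_path:
  assumes "j \<le> r"
  shows "BV n v j = \<phi> ` {-int j..int j}"
  using assms
proof (induction j)
  case (Suc j)
  have IH: "BV n v j = \<phi> ` {-int j..int j}" using Suc by simp
  have adj: "adjacent (rauzy_arcs L n) rauzy_tail rauzy_head (\<phi> i) y \<longleftrightarrow> y = \<phi> (i + 1) \<or> y = \<phi> (i - 1)"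
    if "i \<in> {-int j..int j}" for i y
    using regular_adjacent[OF path_regular n, of i y] path_succ[of i] path_pred[of i] that Suc.prems by auto
  show ?case
  proof (intro equalityI subsetI)
    fix y assume "y \<in> BV n v (Suc j)"
    then consider i where "i \<in> {-int j..int j}" "y = \<phi> i"
      | i where "i \<in> {-int j..int j}" "y = \<phi> (i + 1) \<or> y = \<phi> (i - 1)"
      unfolding ball_verts.simps IH using adj by auto
    then show "y \<in> \<phi> ` {-int (Suc j)..int (Suc j)}" by cases auto
  next
    fix y assume "y \<in> \<phi> ` {-int (Suc j)..int (Suc j)}"
    then obtain k where k: "k \<in> {-int (Suc j)..int (Suc j)}" "y = \<phi> k" by auto
    have y: "y \<in> rauzy_verts L n" using path_lang[of k] k Suc.prems by (simp add: rauzy_verts_def)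
    consider "k \<in> {-int j..int j}" | "k = int j + 1" | "k = - int j - 1" using k by auto linarith
    then show "y \<in> BV n v (Suc j)"
    proof cases
      case 1
      then show ?thesis unfolding ball_verts.simps IH using k by auto
    next
      case 2
      then have "adjacent (rauzy_arcs L n) rauzy_tail rauzy_head (\<phi> (int j)) y" using adj k by simp
      then show ?thesis unfolding ball_verts.simps IH using y by auto
    next
      case 3
      then have "adjacent (rauzy_arcs L n) rauzy_tail rauzy_head (\<phi> (- int j)) y" using adj k by simp
      then show ?thesis unfolding ball_verts.simps IH using y by auto
    qed
  qed
qed simp

text \<open>The spare level of depth, \<open>j < r\<close>, matters at the right end: the arc
  leaving \<open>\<phi> j\<close> leads to \<open>\<phi> (j + 1)\<close>, and injectivity up to
  \<open>r\<close> shows that this vertex lies outside the ball. Hence no arc closes the path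
  up.\<close>

lemma ball_edges_path:
  assumes "j < r" "2 * r \<le> M"
  shows "BE n v j = (\<lambda>i. \<phi> i @ [last (\<phi> (i + 1))]) ` {-int j..<int j}"
proof -
  have arc: "{w \<in> rauzy_arcs L n. butlast w = \<phi> i} = {\<phi> i @ [last (\<phi> (i + 1))]}"
    "tl (\<phi> i @ [last (\<phi> (i + 1))]) = \<phi> (i + 1)" if "i \<in> {-int j..int j}" for i
    using regular_arcs[OF path_regular n, of i] path_succ[of i] that assms by auto
  have inj: "inj_on \<phi> {-int r..int r}" using path_inj assms by simp
  show ?thesis
  proof (intro equalityI subsetI)
    fix e assume "e \<in> BE n v j"
    then have e: "e \<in> rauzy_arcs L n" "butlast e \<in> \<phi> ` {-int j..int j}" "tl e \<in> \<phi> ` {-int j..int j}"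
      using ball_verts_path[of j] assms by (auto simp: ball_edges_def rauzy_tail_def rauzy_head_def)
    then obtain i where i: "i \<in> {-int j..int j}" "butlast e = \<phi> i" by auto
    then have ei: "e = \<phi> i @ [last (\<phi> (i + 1))]" using arc(1)[OF i(1)] e(1) by blast
    then obtain k where k: "k \<in> {-int j..int j}" "\<phi> (i + 1) = \<phi> k" using e(3) arc(2)[OF i(1)] by auto
    have "i + 1 = k"
      using inj_onD[OF inj k(2)] i(1) k(1) assms by auto
    then show "e \<in> (\<lambda>i. \<phi> i @ [last (\<phi> (i + 1))]) ` {-int j..<int j}"
      using ei i(1) k(1) by auto
  next
    fix e assume "e \<in> (\<lambda>i. \<phi> i @ [last (\<phi> (i + 1))]) ` {-int j..<int j}"
    then obtain i where i: "i \<in> {-int j..<int j}" "e = \<phi> i @ [last (\<phi> (i + 1))]" by auto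
    then have "e \<in> rauzy_arcs L n" "butlast e = \<phi> i" "tl e = \<phi> (i + 1)"
      using arc[of i] by auto
    then show "e \<in> BE n v j"
      using ball_verts_path[of j] assms i by (auto simp: ball_edges_def rauzy_tail_def rauzy_head_def)
  qed
qed

lemma ball_iso_line:
  assumes "j < r" "2 * r \<le> M"
  shows "rooted_iso True (BV n v j) (BE n v j) rauzy_tail rauzy_head v
    {-int j..int j} {-int j..<int j} (\<lambda>i. i) (\<lambda>i. i + 1) 0"
proof -
  let ?g = "\<lambda>i. \<phi> i @ [last (\<phi> (i + 1))]"
  have inj: "inj_on \<phi> {-int r..int r}" using path_inj assms by simp
  have "bij_betw \<phi> {-int j..int j} (BV n v j)"
    using inj_on_subset[OF inj, of "{-int j..int j}"] assms ball_verts_path[of j] by (auto simp: bij_betw_def)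
  moreover have "inj_on ?g {-int j..<int j}"
  proof (rule inj_onI)
    fix x y assume xy: "x \<in> {-int j..<int j}" "y \<in> {-int j..<int j}" "?g x = ?g y"
    then have "\<phi> x = \<phi> y" by simp
    then show "x = y" using inj_onD[OF inj] xy(1,2) assms by auto
  qed
  then have "bij_betw ?g {-int j..<int j} (BE n v j)"
    using ball_edges_path[OF assms] by (simp add: bij_betw_def)
  moreover have "rauzy_tail (?g i) = \<phi> i" "rauzy_head (?g i) = \<phi> (i + 1)" if "i \<in> {-int j..<int j}" for i
    using regular_arcs(2)[OF path_regular n, of i] path_succ[of i] that assms
    by (auto simp: rauzy_tail_def rauzy_head_def)
  ultimately have "rooted_iso True {-int j..int j} {-int j..<int j} (\<lambda>i. i) (\<lambda>i. i + 1) 0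
      (BV n v j) (BE n v j) rauzy_tail rauzy_head v"
    unfolding rooted_iso_def same_ends_def by (intro exI[of _ \<phi>] exI[of _ ?g]) simp
  \<comment> \<open>Both maps are explicit from the line to the ball; the isomorphism asked for is
    the inverse.\<close>
  then show ?thesis by (rule rooted_iso_sym) (auto simp: wf_rooted_def)
qed

end

end

context almost_prolongable_language
begin

lemma ratio_imp_directed_line:
  assumes "ratio \<longlonglongrightarrow> 1"
  shows "BS_converges_to_line True L"
  unfolding BS_converges_to_line_def
proof
  fix r :: nat
  \<comment> \<open>The depth is \<open>Suc r\<close> because the radius must be smaller than the
    depth; excluding periods up to \<open>2 * Suc r\<close> makes the path injective over that whole
    depth.\<close>
  let ?D = "\<lambda>n. deep_words L (2 * Suc r) n (Suc r)"
  let ?f = "\<lambda>n. ball_freq True L n r {-int r..int r} {-int r..<int r} (\<lambda>i. i) (\<lambda>i. i + 1) 0"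
  let ?e = "\<lambda>n. real (card (lang_n L n - ?D n)) / real (complexity L n)"
  have "(\<lambda>n. 1 - ?e n) \<longlonglongrightarrow> 1 - 0"
    by (intro tendsto_intros not_deep_ratio_tendsto_0 assms)
  then have lim: "(\<lambda>n. 1 - ?e (Suc n)) \<longlonglongrightarrow> 1" unfolding diff_0_right by (rule LIMSEQ_Suc)
  have le: "1 - ?e n \<le> ?f n" if "0 < n" for n
  proof -
    let ?S = "{v \<in> lang_n L n. rooted_iso True (BV n v r) (BE n v r) rauzy_tail rauzy_head v
      {-int r..int r} {-int r..<int r} (\<lambda>i. i) (\<lambda>i. i + 1) 0}"
    have D: "?D n \<subseteq> lang_n L n" by (rule deep_words_subset)
    have "?D n \<subseteq> ?S" using ball_iso_line[of _ "2 * Suc r" n "Suc r" r] D that by blast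
    then have "card (?D n) \<le> card ?S" by (intro card_mono) auto
    moreover have "card (lang_n L n - ?D n) = complexity L n - card (?D n)"
      unfolding complexity_def by (rule card_Diff_subset[OF finite_subset[OF D finite_lang_n] D])
    moreover have "card (?D n) \<le> complexity L n"
      unfolding complexity_def by (rule card_mono[OF finite_lang_n D])
    ultimately have "real (complexity L n) - card (lang_n L n - ?D n) \<le> card ?S" by linarith
    then have "(real (complexity L n) - card (lang_n L n - ?D n)) / complexity L n \<le> card ?S / complexity L n"
      by (rule divide_right_mono) simp
    then show ?thesis using complexity_pos[of n] by (simp add: ball_freq_eq diff_divide_distrib)
  qed
  have "(\<lambda>n. ?f (Suc n)) \<longlonglongrightarrow> 1"
    by (rule LIMSEQ_squeeze[OF le[OF zero_less_Suc] ball_freq_bounds(2) lim tendsto_const])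
  then show "?f \<longlonglongrightarrow> 1" by (rule LIMSEQ_imp_Suc)
qed

end

section \<open>The adjacency operator\<close>

definition arc_count :: "'a list set \<Rightarrow> nat \<Rightarrow> 'a list \<Rightarrow> 'a list \<Rightarrow> nat" where
  "arc_count L n u x = card {w \<in> rauzy_arcs L n. butlast w = u \<and> tl w = x}"

lemma rauzy_adj_sym: "rauzy_adj L n u v = rauzy_adj L n v u"
  unfolding rauzy_adj_def by (rule arg_cong[of _ _ card]) auto

context factorial_language
begin

lemma sum_arc_count:
  assumes "u \<in> lang_n L n"
  shows "(\<Sum>x\<in>lang_n L n. arc_count L n u x) = out_deg L u"
    "(\<Sum>x\<in>lang_n L n. arc_count L n x u) = in_deg L u"
proof -
  have "(\<Sum>x\<in>lang_n L n. \<Sum>w\<in>{w \<in> {w \<in> rauzy_arcs L n. butlast w = u}. tl w = x}. 1)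
      = (\<Sum>w\<in>{w \<in> rauzy_arcs L n. butlast w = u}. 1 :: nat)"
    using tl_butlast_lang_n(1) by (intro sum.group) (auto simp: rauzy_arcs_eq)
  moreover have "{w \<in> {w \<in> rauzy_arcs L n. butlast w = u}. tl w = x} = {w \<in> rauzy_arcs L n. butlast w = u \<and> tl w = x}" for x
    by blast
  ultimately show "(\<Sum>x\<in>lang_n L n. arc_count L n u x) = out_deg L u"
    by (simp only: arc_count_def card_eq_sum[symmetric] card_out_arcs[OF assms])
  have "(\<Sum>x\<in>lang_n L n. \<Sum>w\<in>{w \<in> {w \<in> rauzy_arcs L n. tl w = u}. butlast w = x}. 1)
      = (\<Sum>w\<in>{w \<in> rauzy_arcs L n. tl w = u}. 1 :: nat)"
    using tl_butlast_lang_n(2) by (intro sum.group) (auto simp: rauzy_arcs_eq)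
  moreover have "{w \<in> {w \<in> rauzy_arcs L n. tl w = u}. butlast w = x} = {w \<in> rauzy_arcs L n. butlast w = x \<and> tl w = u}" for x
    by blast
  ultimately show "(\<Sum>x\<in>lang_n L n. arc_count L n x u) = in_deg L u"
    by (simp only: arc_count_def card_eq_sum[symmetric] card_in_arcs[OF assms])
qed

lemma rauzy_adj_Un:
  "rauzy_adj L n u x = card ({w \<in> rauzy_arcs L n. butlast w = u \<and> tl w = x} \<union> {w \<in> rauzy_arcs L n. butlast w = x \<and> tl w = u})"
  unfolding rauzy_adj_def rauzy_tail_def rauzy_head_def by (rule arg_cong[of _ _ card]) blast

lemma rauzy_adj_le: "rauzy_adj L n u x \<le> arc_count L n u x + arc_count L n x u"
  unfolding rauzy_adj_Un arc_count_def by (rule card_Un_le)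

text \<open>The adjacency entry counts arcs in a union, so a loop is counted once there but twice in
  the sum; without a loop at \<open>u\<close> the union is disjoint.\<close>

lemma rauzy_adj_eq:
  assumes "arc_count L n u u = 0"
  shows "rauzy_adj L n u x = arc_count L n u x + arc_count L n x u"
proof (cases "x = u")
  case True
  then show ?thesis using rauzy_adj_le[of n u u] assms by simp
next
  case False
  then show ?thesis unfolding rauzy_adj_Un arc_count_def by (intro card_Un_disjoint) auto
qed

lemma rauzy_adj_row_sum_le:
  assumes "u \<in> lang_n L n"
  shows "(\<Sum>x\<in>lang_n L n. real (rauzy_adj L n u x)) \<le> 2 * real CARD('a)"
proof -
  have "(\<Sum>x\<in>lang_n L n. rauzy_adj L n u x) \<le> (\<Sum>x\<in>lang_n L n. arc_count L n u x + arc_count L n x u)"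
    by (intro sum_mono rauzy_adj_le)
  also have "\<dots> = out_deg L u + in_deg L u" by (simp add: sum.distrib sum_arc_count[OF assms])
  also have "\<dots> \<le> 2 * CARD('a)" using deg_le_card[of L u] by simp
  finally have "real (\<Sum>x\<in>lang_n L n. rauzy_adj L n u x) \<le> real (2 * CARD('a))" by (simp only: of_nat_le_iff)
  then show ?thesis by simp
qed

text \<open>Along an arc the letters move one place to the left. A directed closed walk of one or
  two arcs therefore forces period 1 or 2.\<close>

lemma arc_nth:
  assumes "w \<in> rauzy_arcs L n" "t + 1 < n"
  shows "butlast w ! (t + 1) = tl w ! t"
proof -
  have "length w = Suc n" using assms by (simp add: rauzy_arcs_eq lang_n_def)
  then show ?thesis using assms(2) by (simp add: nth_butlast nth_tl)
qed

lemma arc_count_pos: "arc_count L n u x \<noteq> 0 \<Longrightarrow> \<exists>w\<in>rauzy_arcs L n. butlast w = u \<and> tl w = x"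
  unfolding arc_count_def by (metis (mono_tags, lifting) card.empty empty_Collect_eq)

lemma loop_imp_periodic:
  assumes "arc_count L n u u \<noteq> 0" "u \<in> lang_n L n"
  shows "word_periodic 1 u"
  using arc_count_pos[OF assms(1)] arc_nth assms(2)
  unfolding word_periodic_def by (fastforce simp: lang_n_def)

lemma two_cycle_imp_periodic:
  assumes "arc_count L n u x \<noteq> 0" "arc_count L n x u \<noteq> 0" "u \<in> lang_n L n"
  shows "word_periodic 2 u"
  unfolding word_periodic_def
proof (intro allI impI)
  fix t assume t: "t + 2 < length u"
  have len: "length u = n" using assms(3) by (simp add: lang_n_def)
  obtain w w' where w: "w \<in> rauzy_arcs L n" "butlast w = u" "tl w = x"
    "w' \<in> rauzy_arcs L n" "butlast w' = x" "tl w' = u"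
    using arc_count_pos[OF assms(1)] arc_count_pos[OF assms(2)] by blast
  have "u ! (t + 2) = x ! (t + 1)" using arc_nth[OF w(1), of "t + 1"] w t len by simp
  also have "\<dots> = u ! t" using arc_nth[OF w(4), of t] w t len by simp
  finally show "u ! (t + 2) = u ! t" .
qed

text \<open>An arc is its tail followed by the last letter of its head, which exists for
  \<open>0 < n\<close>. For \<open>n = 0\<close> the arcs are single letters, all of them loops at
  the empty word.\<close>

lemma arc_count_le_1:
  assumes "0 < n"
  shows "arc_count L n u x \<le> 1"
proof -
  have "w = w'" if "w \<in> rauzy_arcs L n" "w' \<in> rauzy_arcs L n" "butlast w = butlast w'" "tl w = tl w'" for w w'
  proof -
    have len: "length w = Suc n" "length w' = Suc n" using that by (auto simp: rauzy_arcs_eq lang_n_def)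
    have "last y = last (tl y)" "y \<noteq> []" if "length y = Suc n" for y :: "'a list"
      using that assms by (cases y; auto)+
    then show ?thesis using that(3,4) len by (metis append_butlast_last_id)
  qed
  then show ?thesis unfolding arc_count_def One_nat_def by (subst card_le_Suc0_iff_eq) auto
qed

text \<open>At a regular vertex the row of the adjacency operator is that of
  \<open>S + S\<inverse>\<close>. Excluding period 1 rules out a loop, which the adjacency entry
  would count only once.\<close>

lemma rauzy_adj_regular:
  assumes "x \<in> regular_words L M n" "0 < n" "1 \<le> M"
  shows "real (rauzy_adj L n x y) = of_bool (y = word_succ L x) + of_bool (y = word_pred L x)"
proof -
  have "x \<in> lang_n L n" "\<not> word_periodic 1 x" using assms by (auto simp: regular_words_def)
  then have "arc_count L n x x = 0" using loop_imp_periodic by blast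
  then have "rauzy_adj L n x y = arc_count L n x y + arc_count L n y x" by (rule rauzy_adj_eq)
  moreover have "{w \<in> rauzy_arcs L n. butlast w = x \<and> tl w = y} = {w \<in> {w \<in> rauzy_arcs L n. butlast w = x}. tl w = y}"
    "{w \<in> rauzy_arcs L n. butlast w = y \<and> tl w = x} = {w \<in> {w \<in> rauzy_arcs L n. tl w = x}. butlast w = y}" by auto
  moreover have "{w \<in> {x @ [last (word_succ L x)]}. tl w = y} = (if y = word_succ L x then {x @ [last (word_succ L x)]} else {})"
    using regular_arcs(2)[OF assms(1,2)] by auto
  moreover have "{w \<in> {hd (word_pred L x) # x}. butlast w = y} = (if y = word_pred L x then {hd (word_pred L x) # x} else {})"
    using regular_arcs(4)[OF assms(1,2)] by auto
  ultimately show ?thesis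
    unfolding arc_count_def regular_arcs(1,3)[OF assms(1,2)] by simp
qed

text \<open>This is \<open>C\<^sub>m(S + S\<inverse>) = S\<^sup>m + S\<^sup>-\<^sup>m\<close>, valid
  as long as a walk of \<open>m\<close> steps cannot leave the regular part of the path. The
  induction moves to \<open>i + 1\<close> and \<open>i - 1\<close> with a smaller \<open>m\<close>,
  so \<open>\<bar>i\<bar> + m\<close> does not grow.\<close>

lemma cheb_entry_path:
  assumes v: "v \<in> deep_words L M n r" "0 < n" "1 \<le> M" and "\<bar>i\<bar> + int m \<le> int r"
  shows "cheb_entry L n m (word_path L v i) y
    = of_bool (y = word_path L v (i + int m)) + of_bool (y = word_path L v (i - int m))"
  using assms(4)
proof (induction m arbitrary: i rule: less_induct)
  case (less m)
  let ?\<phi> = "word_path L v"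
  have adj: "real (rauzy_adj L n (?\<phi> i) x) = of_bool (x = ?\<phi> (i + 1)) + of_bool (x = ?\<phi> (i - 1))"
    if "\<bar>i\<bar> < int r" for i x
    using rauzy_adj_regular[OF path_regular[OF v(1,2)] v(2,3)] path_succ[OF v(1,2)] path_pred[OF v(1,2)] that
    by simp
  consider "m = 0" | "m = Suc 0" | k where "m = Suc (Suc k)" by (metis not0_implies_Suc)
  then show ?case
  proof cases
    case 1
    then show ?thesis by auto
  next
    case 2
    then show ?thesis using adj[of i y] less.prems by simp
  next
    case 3
    have mem: "?\<phi> (i + 1) \<in> lang_n L n" "?\<phi> (i - 1) \<in> lang_n L n"
      using path_lang[OF v(1,2)] less.prems 3 by auto
    have "cheb_entry L n m (?\<phi> i) y =
        (\<Sum>x\<in>lang_n L n. (of_bool (x = ?\<phi> (i + 1)) + of_bool (x = ?\<phi> (i - 1))) * cheb_entry L n (Suc k) x y)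
        - cheb_entry L n k (?\<phi> i) y"
      using adj[of i] less.prems 3 by simp
    also have "\<dots> = cheb_entry L n (Suc k) (?\<phi> (i + 1)) y + cheb_entry L n (Suc k) (?\<phi> (i - 1)) y
        - cheb_entry L n k (?\<phi> i) y"
      by (simp only: sum_of_bool_mult[OF finite_lang_n mem])
    \<comment> \<open>Of the four terms coming from \<open>Suc k\<close>, the two at positions
      \<open>i + k\<close> and \<open>i - k\<close> are cancelled by the subtracted
      \<open>cheb_entry L n k\<close>.\<close>
    also have "\<dots> = of_bool (y = ?\<phi> (i + int m)) + of_bool (y = ?\<phi> (i - int m))"
      using less.IH[of "Suc k" "i + 1"] less.IH[of "Suc k" "i - 1"] less.IH[of k i] less.prems 3
      by (simp add: algebra_simps)
    finally show ?thesis .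
  qed
qed

lemma cheb_entry_diag_deep:
  assumes "v \<in> deep_words L (2 * m) n m" "0 < n" "0 < m"
  shows "cheb_entry L n m v v = 0"
proof -
  have "word_path L v 0 \<noteq> word_path L v (int m)" "word_path L v (- int m) \<noteq> word_path L v 0"
    using path_neq[OF assms(1,2), of 0 "int m"] path_neq[OF assms(1,2), of "- int m" 0] assms(3) by auto
  then show ?thesis
    using cheb_entry_path[OF assms(1,2), of 0 m v] assms(3) by (simp add: path_0[OF assms(1,2)])
qed

text \<open>Words that are not deep are controlled by this bound alone, which is uniform in
  \<open>n\<close>. In its base, \<open>2 CARD('a)\<close> is the row sum bound, paid for the
  multiplication in the recurrence, and 1 is paid for the subtracted term.\<close>

lemma cheb_entry_bound:
  assumes "u \<in> lang_n L n"
  shows "\<bar>cheb_entry L n m u v\<bar> \<le> 2 * (2 * real CARD('a) + 1) ^ m"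
  using assms
proof (induction m arbitrary: u rule: less_induct)
  case (less m)
  let ?K = "2 * real CARD('a)"
  have K: "0 \<le> ?K" by simp
  consider "m = 0" | "m = Suc 0" | k where "m = Suc (Suc k)" by (metis not0_implies_Suc)
  then show ?case
  proof cases
    case 1
    then show ?thesis by simp
  next
    case 2
    have "real (rauzy_adj L n u v) \<le> arc_count L n u v + arc_count L n v u"
      using rauzy_adj_le[of n u v] by linarith
    also have "\<dots> \<le> ?K + ?K"
    proof -
      have "arc_count L n u v \<le> card {w \<in> rauzy_arcs L n. butlast w = u}"
        unfolding arc_count_def by (intro card_mono) auto
      moreover have "arc_count L n v u \<le> card {w \<in> rauzy_arcs L n. tl w = u}"
        unfolding arc_count_def by (intro card_mono) auto
      ultimately show ?thesis
        using deg_le_card[of L u] card_out_arcs[OF less.prems] card_in_arcs[OF less.prems] by linarith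
    qed
    finally show ?thesis using 2 by simp
  next
    case 3
    let ?b = "2 * (?K + 1) ^ Suc k"
    have "\<bar>\<Sum>x\<in>lang_n L n. real (rauzy_adj L n u x) * cheb_entry L n (Suc k) x v\<bar>
        \<le> (\<Sum>x\<in>lang_n L n. real (rauzy_adj L n u x) * ?b)"
      using less.IH[of "Suc k"] 3
      by (intro order_trans[OF sum_abs] sum_mono) (auto simp: abs_mult intro!: mult_left_mono)
    also have "\<dots> \<le> ?K * ?b"
      unfolding sum_distrib_right[symmetric]
      by (intro mult_right_mono rauzy_adj_row_sum_le less.prems) simp
    finally have 1: "\<bar>\<Sum>x\<in>lang_n L n. real (rauzy_adj L n u x) * cheb_entry L n (Suc k) x v\<bar> \<le> ?K * ?b" .
    have "\<bar>cheb_entry L n k u v\<bar> \<le> 2 * (?K + 1) ^ k"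
      using less.IH[of k u] 3 less.prems by simp
    also have "\<dots> \<le> ?b"
      by (intro mult_left_mono power_increasing) auto
    finally have 2: "\<bar>cheb_entry L n k u v\<bar> \<le> ?b" .
    have "\<bar>cheb_entry L n m u v\<bar> \<le> ?K * ?b + ?b"
      unfolding 3 cheb_entry.simps using 1 2 by (rule order_trans[OF abs_triangle_ineq4 add_mono])
    also have "\<dots> = 2 * (?K + 1) ^ m" by (simp add: 3 algebra_simps)
    finally show ?thesis .
  qed
qed

text \<open>Without loops and 2-cycles at \<open>u\<close> all entries of its row are 0 or 1, so the
  sum of their squares is the row sum, and this is the degree.\<close>

lemma square_row_sum:
  assumes "u \<in> lang_n L n" "0 < n" "\<not> word_periodic 1 u" "\<not> word_periodic 2 u"
  shows "(\<Sum>x\<in>lang_n L n. real (rauzy_adj L n u x) * real (rauzy_adj L n x u)) = out_deg L u + in_deg L u"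
proof -
  have "rauzy_adj L n u x * rauzy_adj L n x u = arc_count L n u x + arc_count L n x u" for x
  proof -
    have "arc_count L n u u = 0" using loop_imp_periodic assms by blast
    then have "rauzy_adj L n u x = arc_count L n u x + arc_count L n x u" by (rule rauzy_adj_eq)
    moreover have "arc_count L n u x = 0 \<or> arc_count L n x u = 0" using two_cycle_imp_periodic assms by blast
    moreover have "arc_count L n u x = 0 \<or> arc_count L n u x = 1" "arc_count L n x u = 0 \<or> arc_count L n x u = 1"
      using arc_count_le_1[OF assms(2), of u x] arc_count_le_1[OF assms(2), of x u] by linarith+
    ultimately show ?thesis unfolding rauzy_adj_sym[of L n x u] by auto
  qed
  then have "(\<Sum>x\<in>lang_n L n. rauzy_adj L n u x * rauzy_adj L n x u) = out_deg L u + in_deg L u"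
    by (simp add: sum.distrib sum_arc_count[OF assms(1)])
  then show ?thesis unfolding of_nat_mult[symmetric] of_nat_sum[symmetric] by (simp only:)
qed

text \<open>As \<open>C\<^sub>2(x) = x\<^sup>2 - 2\<close>, the trace is the number of arc ends
  minus \<open>2 p(n)\<close>, up to the words of period 1 or 2. The first factor of the bound
  counts these words, the second bounds the discrepancy at each of them.\<close>

lemma cheb_trace_2_bound:
  assumes "0 < n"
  shows "\<bar>(\<Sum>v\<in>lang_n L n. cheb_entry L n 2 v v) - 2 * (real (complexity L (Suc n)) - real (complexity L n))\<bar>
    \<le> (real CARD('a) + real CARD('a) ^ 2) * (2 * (2 * real CARD('a) + 1) ^ 2 + 2 + 2 * real CARD('a))"
proof -
  let ?k = "real CARD('a)"
  let ?P = "{w :: 'a list. length w = n \<and> word_periodic 1 w} \<union> {w. length w = n \<and> word_periodic 2 w}"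
  let ?d = "\<lambda>v. cheb_entry L n 2 v v + 2 - real (out_deg L v + in_deg L v)"
  let ?c = "2 * (2 * ?k + 1) ^ 2 + 2 + 2 * ?k"
  have fin: "finite ?P" by (rule finite_subset[OF _ finite_words_length_eq[of n]]) auto
  have zero: "?d v = 0" if "v \<in> lang_n L n - ?P" for v
  proof -
    have "v \<in> lang_n L n" "\<not> word_periodic 1 v" "\<not> word_periodic 2 v"
      using that by (auto simp: lang_n_def)
    from square_row_sum[OF this(1) assms this(2,3)] show ?thesis by (simp add: numeral_2_eq_2)
  qed
  have bound: "\<bar>?d v\<bar> \<le> ?c" if "v \<in> lang_n L n" for v
  proof -
    have "real (out_deg L v) \<le> ?k" "real (in_deg L v) \<le> ?k" using deg_le_card[of L v] by simp_all
    then have D: "0 \<le> real (out_deg L v + in_deg L v)" "real (out_deg L v + in_deg L v) \<le> 2 * ?k" by simp_all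
    have "\<bar>a\<bar> \<le> b \<Longrightarrow> 0 \<le> d \<Longrightarrow> d \<le> e \<Longrightarrow> \<bar>a + 2 - d\<bar> \<le> b + 2 + e" for a b d e :: real by linarith
    from this[OF cheb_entry_bound[OF that] D] show ?thesis .
  qed
  have "card ?P \<le> CARD('a) ^ 1 + CARD('a) ^ 2"
    by (intro order_trans[OF card_Un_le] add_mono card_word_periodic_le) auto
  moreover have "card (lang_n L n \<inter> ?P) \<le> card ?P" by (intro card_mono fin) auto
  ultimately have cP: "real (card (lang_n L n \<inter> ?P)) \<le> ?k + ?k ^ 2"
    by (metis (mono_tags, lifting) of_nat_add of_nat_le_iff of_nat_power order_trans power_one_right)
  have "(\<Sum>v\<in>lang_n L n. ?d v) = (\<Sum>v\<in>lang_n L n \<inter> ?P. ?d v)"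
    using zero by (intro sum.mono_neutral_right) auto
  also have "\<bar>\<dots>\<bar> \<le> (\<Sum>v\<in>lang_n L n \<inter> ?P. ?c)"
    by (intro order_trans[OF sum_abs] sum_mono bound) auto
  also have "\<dots> = real (card (lang_n L n \<inter> ?P)) * ?c" by simp
  also have "\<dots> \<le> (?k + ?k ^ 2) * ?c"
    by (intro mult_right_mono cP) simp
  finally have le: "\<bar>\<Sum>v\<in>lang_n L n. ?d v\<bar> \<le> (?k + ?k ^ 2) * ?c" .
  have "(\<Sum>v\<in>lang_n L n. real (out_deg L v + in_deg L v)) = 2 * real (complexity L (Suc n))"
    unfolding of_nat_sum[symmetric] sum_deg by simp
  then have "(\<Sum>v\<in>lang_n L n. ?d v) = (\<Sum>v\<in>lang_n L n. cheb_entry L n 2 v v)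
      - 2 * (real (complexity L (Suc n)) - real (complexity L n))"
    by (simp only: sum_subtractf sum.distrib sum_constant complexity_def) simp
  then show ?thesis using le by simp
qed

end

context almost_prolongable_language
begin

text \<open>Deep words have zero diagonal entries, and the remaining words, of density tending to 0,
  have bounded ones.\<close>

lemma cheb_trace_tendsto_0:
  assumes "ratio \<longlonglongrightarrow> 1" "0 < m"
  shows "(\<lambda>n. (\<Sum>v\<in>lang_n L n. cheb_entry L n m v v) / complexity L n) \<longlonglongrightarrow> 0"
proof -
  let ?D = "\<lambda>n. deep_words L (2 * m) n m" and ?b = "2 * (2 * real CARD('a) + 1) ^ m"
  let ?T = "\<lambda>n. (\<Sum>v\<in>lang_n L n. cheb_entry L n m v v) / complexity L n"
  let ?e = "\<lambda>n. ?b * (real (card (lang_n L n - ?D n)) / complexity L n)"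
  have "?e \<longlonglongrightarrow> ?b * 0" by (intro tendsto_intros not_deep_ratio_tendsto_0 assms)
  then have "(\<lambda>n. ?e (Suc n)) \<longlonglongrightarrow> 0" unfolding mult_zero_right by (rule LIMSEQ_Suc)
  moreover have "\<bar>?T n\<bar> \<le> ?e n" if "0 < n" for n
  proof -
    have "(\<Sum>v\<in>lang_n L n. cheb_entry L n m v v) = (\<Sum>v\<in>lang_n L n - ?D n. cheb_entry L n m v v)"
      using cheb_entry_diag_deep[OF _ that assms(2)] by (intro sum.mono_neutral_right) auto
    also have "\<bar>\<dots>\<bar> \<le> (\<Sum>v\<in>lang_n L n - ?D n. ?b)"
      by (intro order_trans[OF sum_abs] sum_mono cheb_entry_bound) auto
    also have "\<dots> = ?b * real (card (lang_n L n - ?D n))" by simp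
    finally have "\<bar>\<Sum>v\<in>lang_n L n. cheb_entry L n m v v\<bar> / complexity L n
        \<le> ?b * real (card (lang_n L n - ?D n)) / complexity L n"
      by (rule divide_right_mono) simp
    then show ?thesis by simp
  qed
  ultimately have "(\<lambda>n. \<bar>?T (Suc n)\<bar>) \<longlonglongrightarrow> 0"
    by (intro LIMSEQ_squeeze[of "\<lambda>_. 0" "\<lambda>n. \<bar>?T (Suc n)\<bar>" "\<lambda>n. ?e (Suc n)" 0]) auto
  then have "(\<lambda>n. ?T (Suc n)) \<longlonglongrightarrow> 0" by (simp only: tendsto_rabs_zero_iff)
  then show ?thesis by (rule LIMSEQ_imp_Suc)
qed

lemma cheb_trace_2_convergent_imp:
  assumes "(\<lambda>n. (\<Sum>v\<in>lang_n L n. cheb_entry L n 2 v v) / complexity L n) \<longlonglongrightarrow> l"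
  shows "ratio \<longlonglongrightarrow> 1 + l / 2"
proof -
  let ?T = "\<lambda>n. (\<Sum>v\<in>lang_n L n. cheb_entry L n 2 v v)"
  let ?c = "(real CARD('a) + real CARD('a) ^ 2) * (2 * (2 * real CARD('a) + 1) ^ 2 + 2 + 2 * real CARD('a))"
  let ?p = "\<lambda>n. real (complexity L n)"
  let ?E = "\<lambda>n. (?T n - 2 * (?p (Suc n) - ?p n)) / ?p n"
  have "(\<lambda>n. \<bar>?E (Suc n)\<bar>) \<longlonglongrightarrow> 0"
  proof (rule LIMSEQ_squeeze[of "\<lambda>_. 0" _ "\<lambda>n. ?c / ?p (Suc n)"])
    show "\<bar>?E (Suc n)\<bar> \<le> ?c / ?p (Suc n)" for n
      unfolding abs_divide abs_of_nat by (intro divide_right_mono cheb_trace_2_bound) auto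
    show "(\<lambda>n. ?c / ?p (Suc n)) \<longlonglongrightarrow> 0" by (intro LIMSEQ_Suc inverse_complexity_tendsto_0)
  qed auto
  then have "(\<lambda>n. ?E (Suc n)) \<longlonglongrightarrow> 0" by (simp only: tendsto_rabs_zero_iff)
  then have E: "?E \<longlonglongrightarrow> 0" by (rule LIMSEQ_imp_Suc)
  have "(\<lambda>n. 1 + (?T n / ?p n - ?E n) / 2) \<longlonglongrightarrow> 1 + (l - 0) / 2"
    by (intro tendsto_intros assms E) simp
  moreover have "1 + (?T n / ?p n - ?E n) / 2 = ratio n" for n
    using complexity_pos[of n] by (simp add: diff_divide_distrib)
  ultimately show ?thesis by simp
qed

end

section \<open>Spectra of symmetric matrices\<close>

text \<open>These are \<open>2 T\<^sub>m(x / 2)\<close> for the Chebyshev polynomials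
  \<open>T\<^sub>m\<close> of the first kind, also known as Vieta-Lucas polynomials.\<close>

fun cheb :: "nat \<Rightarrow> real \<Rightarrow> real" where
  "cheb 0 x = 2"
| "cheb (Suc 0) x = x"
| "cheb (Suc (Suc m)) x = x * cheb (Suc m) x - cheb m x"

fun cheb_mat :: "nat \<Rightarrow> real mat \<Rightarrow> real mat" where
  "cheb_mat 0 A = 2 \<cdot>\<^sub>m 1\<^sub>m (dim_row A)"
| "cheb_mat (Suc 0) A = A"
| "cheb_mat (Suc (Suc m)) A = A * cheb_mat (Suc m) A - cheb_mat m A"

section \<open>Trace, similarity and triangular form\<close>

definition mat_trace :: "'a::comm_ring_1 mat \<Rightarrow> 'a" where
  "mat_trace A = (\<Sum>i<dim_row A. A $$ (i, i))"

lemma mat_trace_comm: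
  assumes "A \<in> carrier_mat n n" "B \<in> carrier_mat n n"
  shows "mat_trace (A * B) = mat_trace (B * A)"
proof -
  have *: "mat_trace (X * Y) = (\<Sum>i<n. \<Sum>j<n. X $$ (i, j) * Y $$ (j, i))"
    if "X \<in> carrier_mat n n" "Y \<in> carrier_mat n n" for X Y :: "'a mat"
    using that by (auto simp: mat_trace_def scalar_prod_def atLeast0LessThan intro!: sum.cong)
  show ?thesis
    unfolding *[OF assms] *[OF assms(2,1)]
    by (subst sum.swap) (simp add: mult.commute)
qed

lemma mat_trace_similar:
  assumes "similar_mat_wit A B P Q"
  shows "mat_trace A = mat_trace B"
proof -
  define n where "n = dim_row A"
  note w = similar_mat_witD[OF n_def assms]
  have "mat_trace A = mat_trace (P * (B * Q))"
    using w assoc_mult_mat[of P n n B n Q n] by simp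
  also have "\<dots> = mat_trace (B * Q * P)"
    using w by (intro mat_trace_comm[of _ n]) auto
  also have "B * Q * P = B"
    using w assoc_mult_mat[of B n n Q n P n] by simp
  finally show ?thesis .
qed

lemma cheb_mat_carrier [simp]: "A \<in> carrier_mat n n \<Longrightarrow> cheb_mat m A \<in> carrier_mat n n"
  by (induction m A rule: cheb_mat.induct) auto

lemma cheb_mat_similar:
  assumes "similar_mat_wit A B P Q"
  shows "similar_mat_wit (cheb_mat m A) (cheb_mat m B) P Q"
proof -
  define n where "n = dim_row A"
  note w = similar_mat_witD[OF n_def assms]
  have "cheb_mat m A = P * cheb_mat m B * Q"
  proof (induction m rule: less_induct)
    case (less m)
    consider "m = 0" | "m = Suc 0" | k where "m = Suc (Suc k)" by (metis not0_implies_Suc)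
    then show ?case
    proof cases
      case 1
      have "P * (2 \<cdot>\<^sub>m 1\<^sub>m n) * Q = 2 \<cdot>\<^sub>m (P * Q)"
        using w by (metis mult_smult_assoc_mat mult_smult_distrib one_carrier_mat right_mult_one_mat)
      then show ?thesis using w 1 by auto
    next
      case 3
      define X where "X = cheb_mat (Suc k) B"
      define Y where "Y = cheb_mat k B"
      have c: "X \<in> carrier_mat n n" "Y \<in> carrier_mat n n" unfolding X_def Y_def using w by auto
      have QP: "Q * (P * X * Q) = X * Q"
      proof -
        have "Q * (P * X * Q) = Q * (P * (X * Q))" using w c by (simp add: assoc_mult_mat[of _ n n _ n _ n])
        also have "\<dots> = Q * P * (X * Q)" using w c by (intro assoc_mult_mat[symmetric, of _ n n _ n _ n]) auto
        also have "\<dots> = X * Q" using w c by simp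
        finally show ?thesis .
      qed
      have "A * (P * X * Q) = P * B * (Q * (P * X * Q))"
        using w c by (subst w(3)) (intro assoc_mult_mat[of _ n n _ n _ n], auto)
      also have "\<dots> = P * B * (X * Q)" by (simp add: QP)
      also have "\<dots> = P * (B * X) * Q"
        using w c by (simp add: assoc_mult_mat[of _ n n _ n _ n])
      finally have 1: "A * (P * X * Q) = P * (B * X) * Q" .
      have "P * (B * X - Y) * Q = (P * (B * X) - P * Y) * Q"
        using w c by (subst mult_minus_distrib_mat[of _ n n _ n]) auto
      also have "\<dots> = P * (B * X) * Q - P * Y * Q"
        using w c by (intro minus_mult_distrib_mat[of _ n n _ _ n]) auto
      finally have 2: "P * (B * X - Y) * Q = P * (B * X) * Q - P * Y * Q" .
      show ?thesis
        using less.IH[of "Suc k"] less.IH[of k] 1 2 3 by (simp add: X_def Y_def)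
    qed (use w in auto)
  qed
  then show ?thesis
    using w by (intro similar_mat_witI[of _ _ n]) auto
qed

lemma upper_triangular_mult_index:
  assumes "A \<in> carrier_mat n n" "B \<in> carrier_mat n n" "upper_triangular A" "upper_triangular B"
    and "j \<le> i" "i < n"
  shows "(A * B) $$ (i, j) = (if i = j then A $$ (i, i) * B $$ (i, i) else 0)"
proof -
  have "(A * B) $$ (i, j) = (\<Sum>k\<in>{0..<n}. A $$ (i, k) * B $$ (k, j))"
    using assms by (auto simp: scalar_prod_def)
  also have "\<dots> = (\<Sum>k\<in>{0..<n}. if k = i then (if i = j then A $$ (i, i) * B $$ (i, i) else 0) else 0)"
  proof (rule sum.cong)
    fix k assume k: "k \<in> {0..<n}"
    show "A $$ (i, k) * B $$ (k, j) = (if k = i then (if i = j then A $$ (i, i) * B $$ (i, i) else 0) else 0)"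
    proof (cases "k < i")
      case True
      then have "A $$ (i, k) = 0" using assms by (intro upper_triangularD) auto
      then show ?thesis using True by simp
    next
      case False
      then have "k = i \<or> j < k" using assms by auto
      moreover have "B $$ (k, j) = 0" if "j < k" using assms k that by (intro upper_triangularD) auto
      ultimately show ?thesis using assms by (cases "i = j") auto
    qed
  qed simp
  finally show ?thesis using assms by simp
qed

lemma cheb_mat_upper_triangular:
  assumes "B \<in> carrier_mat n n" "upper_triangular B"
  shows "upper_triangular (cheb_mat m B)" "i < n \<Longrightarrow> cheb_mat m B $$ (i, i) = cheb m (B $$ (i, i))"
proof -
  have "upper_triangular (cheb_mat m B) \<and> (\<forall>i<n. cheb_mat m B $$ (i, i) = cheb m (B $$ (i, i)))"
  proof (induction m rule: less_induct)
    case (less m)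
    consider "m = 0" | "m = Suc 0" | k where "m = Suc (Suc k)" by (metis not0_implies_Suc)
    then show ?case
    proof cases
      case 3
      define X where "X = cheb_mat (Suc k) B"
      define Y where "Y = cheb_mat k B"
      have c: "X \<in> carrier_mat n n" "Y \<in> carrier_mat n n" unfolding X_def Y_def using assms by auto
      have IH: "upper_triangular X" "upper_triangular Y"
        "\<forall>i<n. X $$ (i, i) = cheb (Suc k) (B $$ (i, i))" "\<forall>i<n. Y $$ (i, i) = cheb k (B $$ (i, i))"
        using less.IH[of "Suc k"] less.IH[of k] 3 by (auto simp: X_def Y_def)
      have entry: "(B * X - Y) $$ (i, j) = (if i = j then B $$ (i, i) * X $$ (i, i) - Y $$ (i, i) else 0)"
        if "j \<le> i" "i < n" for i j
        using upper_triangular_mult_index[OF assms(1) c(1) assms(2) IH(1) that] upper_triangularD[OF IH(2), of j i] c assms(1) that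
        by (cases "i = j") auto
      have "upper_triangular (B * X - Y)"
        by (intro upper_triangularI) (subst entry, use c assms in auto)
      moreover have "(B * X - Y) $$ (i, i) = cheb m (B $$ (i, i))" if "i < n" for i
        using entry[of i i] that IH 3 by simp
      ultimately show ?thesis by (simp add: 3 X_def Y_def)
    qed (use assms in auto)
  qed
  then show "upper_triangular (cheb_mat m B)" "i < n \<Longrightarrow> cheb_mat m B $$ (i, i) = cheb m (B $$ (i, i))"
    by auto
qed

text \<open>Read off from a Schur triangular form: \<open>C\<^sub>m\<close> of an upper triangular
  matrix carries \<open>C\<^sub>m\<close> of the eigenvalues on its diagonal, and the trace is
  invariant under similarity.\<close>

lemma mat_trace_cheb_mat:
  assumes "A \<in> carrier_mat n n" "char_poly A = (\<Prod>e\<leftarrow>es. [:- e, 1:])"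
  shows "mat_trace (cheb_mat m A) = (\<Sum>e\<leftarrow>es. cheb m e)"
proof -
  obtain B P Q where "schur_decomposition A es = (B, P, Q)" by (cases "schur_decomposition A es") auto
  from schur_decomposition[OF assms this]
  have s: "similar_mat_wit A B P Q" "upper_triangular B" "diag_mat B = es" by auto
  have B: "B \<in> carrier_mat n n" using similar_mat_witD2[OF assms(1) s(1)] by simp
  have "mat_trace (cheb_mat m A) = mat_trace (cheb_mat m B)"
    by (rule mat_trace_similar[OF cheb_mat_similar[OF s(1)]])
  also have "\<dots> = (\<Sum>i<n. cheb m (B $$ (i, i)))"
    using cheb_mat_carrier[OF B, of m] cheb_mat_upper_triangular(2)[OF B s(2)]
    by (auto simp: mat_trace_def intro!: sum.cong)
  also have "\<dots> = (\<Sum>e\<leftarrow>diag_mat B. cheb m e)"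
    using B by (simp add: diag_mat_def comp_def interv_sum_list_conv_sum_set_nat atLeast0LessThan)
  finally show ?thesis by (simp add: s)
qed

text \<open>The Hermitian form \<open>S\<close> evaluated at an eigenvector equals
  \<open>z R\<close> with \<open>R\<close> the squared norm, and symmetry of the real matrix makes
  \<open>S\<close> its own conjugate.\<close>

lemma symmetric_eigenvalue_real:
  fixes A :: "real mat"
  assumes A: "A \<in> carrier_mat n n" and sym: "\<And>i j. i < n \<Longrightarrow> j < n \<Longrightarrow> A $$ (i, j) = A $$ (j, i)"
    and ev: "eigenvalue (map_mat complex_of_real A) z"
  shows "Im z = 0"
proof -
  from ev A obtain v where v: "v \<in> carrier_vec n" "v \<noteq> 0\<^sub>v n" "map_mat complex_of_real A *\<^sub>v v = z \<cdot>\<^sub>v v"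
    by (auto simp: eigenvalue_def eigenvector_def)
  have row: "(\<Sum>j<n. of_real (A $$ (i, j)) * v $ j) = z * v $ i" if "i < n" for i
  proof -
    have "(map_mat complex_of_real A *\<^sub>v v) $ i = (\<Sum>j<n. of_real (A $$ (i, j)) * v $ j)"
      using that A v(1) by (auto simp: scalar_prod_def atLeast0LessThan intro!: sum.cong)
    then show ?thesis using v that by simp
  qed
  define S where "S = (\<Sum>i<n. \<Sum>j<n. cnj (v $ i) * (of_real (A $$ (i, j)) * v $ j))"
  define R where "R = (\<Sum>i<n. (cmod (v $ i))\<^sup>2)"
  have "S = (\<Sum>i<n. cnj (v $ i) * (z * v $ i))"
    unfolding S_def by (simp add: sum_distrib_left[symmetric] row)
  also have "\<dots> = z * of_real R"
    by (simp add: R_def sum_distrib_left complex_norm_square algebra_simps del: of_real_power)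
  finally have S: "S = z * of_real R" .
  have "cnj S = (\<Sum>i<n. \<Sum>j<n. v $ i * (of_real (A $$ (i, j)) * cnj (v $ j)))"
    by (simp add: S_def)
  also have "\<dots> = (\<Sum>j<n. \<Sum>i<n. v $ i * (of_real (A $$ (i, j)) * cnj (v $ j)))"
    by (rule sum.swap)
  also have "\<dots> = S"
    unfolding S_def by (intro sum.cong refl) (simp add: sym algebra_simps)
  finally have "Im S = 0" by (metis complex_cnj complex.sel(2) complex_surj equation_minus_iff
    neg_equal_zero)
  then have "Im z * R = 0" by (simp add: S)
  moreover have "R \<noteq> 0"
  proof
    assume "R = 0"
    then have "\<forall>i<n. v $ i = 0" unfolding R_def by (subst (asm) sum_nonneg_eq_0_iff) auto
    then have "v = 0\<^sub>v n" using v(1) by (intro eq_vecI) auto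
    then show False using v by simp
  qed
  ultimately show ?thesis by simp
qed

text \<open>Over the complex numbers the polynomial splits and all its roots are real; the
  factorisation descends because the embedding of the reals is injective on coefficients.\<close>

lemma symmetric_char_poly_splits:
  fixes A :: "real mat"
  assumes A: "A \<in> carrier_mat n n" and sym: "\<And>i j. i < n \<Longrightarrow> j < n \<Longrightarrow> A $$ (i, j) = A $$ (j, i)"
  obtains es where "char_poly A = (\<Prod>e\<leftarrow>es. [:- e, 1:])" "length es = n"
proof -
  let ?A = "map_mat complex_of_real A"
  have cA: "?A \<in> carrier_mat n n" using A by simp
  obtain as where as: "char_poly ?A = (\<Prod>a\<leftarrow>as. [:- a, 1:])" "length as = n"
    using char_poly_factorized[OF cA] by blast
  have real: "complex_of_real (Re a) = a" if "a \<in> set as" for a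
  proof -
    have "poly (char_poly ?A) a = 0"
      using that unfolding as(1) by (induction as) auto
    then have "eigenvalue ?A a" using eigenvalue_root_char_poly[OF cA] by simp
    from symmetric_eigenvalue_real[OF A sym this] show ?thesis by (simp add: complex_eq_iff)
  qed
  interpret c: map_poly_comm_ring_hom complex_of_real ..
  have "map_poly complex_of_real (\<Prod>a\<leftarrow>xs. [:- Re a, 1:]) = (\<Prod>a\<leftarrow>xs. [:- a, 1:])"
    if "set xs \<subseteq> set as" for xs
    using that by (induction xs) (auto simp: c.hom_mult map_poly_pCons real simp del: mult_pCons_left)
  then have "map_poly complex_of_real (\<Prod>a\<leftarrow>as. [:- Re a, 1:]) = map_poly complex_of_real (char_poly A)"
    using as(1) of_real_hom.char_poly_hom[OF A, where ?'a = complex] by simp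
  then have "coeff (map_poly complex_of_real (\<Prod>a\<leftarrow>as. [:- Re a, 1:])) i
      = coeff (map_poly complex_of_real (char_poly A)) i" for i
    by (rule arg_cong)
  then have "coeff (\<Prod>a\<leftarrow>as. [:- Re a, 1:]) i = coeff (char_poly A) i" for i
    by (simp only: coeff_map_poly[of complex_of_real, OF of_real_0] of_real_eq_iff)
  then have "(\<Prod>a\<leftarrow>as. [:- Re a, 1:]) = char_poly A" by (intro poly_eqI)
  then show ?thesis using as(2) that[of "map Re as"] by (simp add: comp_def)
qed

text \<open>The eigenvector equation is evaluated at a coordinate of largest modulus. For Rauzy
  graphs this puts all spectra into one interval independent of \<open>n\<close>.\<close>

lemma eigenvalue_row_sum_bound:
  fixes A :: "real mat"
  assumes A: "A \<in> carrier_mat n n" and K: "\<And>i. i < n \<Longrightarrow> (\<Sum>j<n. \<bar>A $$ (i, j)\<bar>) \<le> K"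
    and ev: "eigenvalue A e"
  shows "\<bar>e\<bar> \<le> K"
proof -
  from ev A obtain v where v: "v \<in> carrier_vec n" "v \<noteq> 0\<^sub>v n" "A *\<^sub>v v = e \<cdot>\<^sub>v v"
    by (auto simp: eigenvalue_def eigenvector_def)
  have n: "0 < n" using v by (cases n) auto
  obtain i where i: "i < n" and max: "\<And>j. j < n \<Longrightarrow> \<bar>v $ j\<bar> \<le> \<bar>v $ i\<bar>"
  proof -
    have "Max ((\<lambda>j. \<bar>v $ j\<bar>) ` {..<n}) \<in> (\<lambda>j. \<bar>v $ j\<bar>) ` {..<n}"
      using n by (intro Max_in) auto
    then obtain i where "i < n" "Max ((\<lambda>j. \<bar>v $ j\<bar>) ` {..<n}) = \<bar>v $ i\<bar>" by auto
    then show ?thesis using that by (metis Max_ge finite_imageI finite_lessThan imageI lessThan_iff)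
  qed
  have pos: "0 < \<bar>v $ i\<bar>"
  proof (rule ccontr)
    assume "\<not> 0 < \<bar>v $ i\<bar>"
    then have "v $ j = 0" if "j < n" for j using max[OF that] by simp
    then have "v = 0\<^sub>v n" using v(1) by (intro eq_vecI) auto
    then show False using v by simp
  qed
  have "e * v $ i = (A *\<^sub>v v) $ i" using v i by simp
  also have "\<dots> = (\<Sum>j<n. A $$ (i, j) * v $ j)"
    using i A v(1) by (auto simp: scalar_prod_def atLeast0LessThan intro!: sum.cong)
  finally have "\<bar>e\<bar> * \<bar>v $ i\<bar> \<le> (\<Sum>j<n. \<bar>A $$ (i, j) * v $ j\<bar>)"
    by (metis abs_mult sum_abs)
  also have "\<dots> \<le> (\<Sum>j<n. \<bar>A $$ (i, j)\<bar> * \<bar>v $ i\<bar>)"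
    unfolding abs_mult by (intro sum_mono mult_left_mono max) auto
  also have "\<dots> \<le> K * \<bar>v $ i\<bar>"
    unfolding sum_distrib_right[symmetric] by (intro mult_right_mono K i) auto
  finally show ?thesis using pos by simp
qed

section \<open>The arcsine law\<close>

lemma cheb_cos: "cheb m (2 * cos t) = 2 * cos (real m * t)"
proof (induction m "2 * cos t" rule: cheb.induct)
  case (3 m)
  have "cos (real (Suc (Suc m)) * t) = cos (real (Suc m) * t + t)"
    "cos (real m * t) = cos (real (Suc m) * t - t)"
    by (simp_all add: algebra_simps)
  then show ?case using 3 by (simp add: cos_add cos_diff)
qed simp_all

lemma continuous_on_cheb: "continuous_on S (cheb m)"
proof (induction m rule: less_induct)
  case (less m)
  consider "m = 0" | "m = Suc 0" | k where "m = Suc (Suc k)" by (metis not0_implies_Suc)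
  then show ?case
  proof cases
    case 3
    have "continuous_on S (\<lambda>x. x * cheb (Suc k) x - cheb k x)"
      using less.IH[of "Suc k"] less.IH[of k] 3 by (intro continuous_intros) auto
    then show ?thesis by (simp add: 3)
  qed auto
qed

lemma cheb_measurable [measurable]: "cheb m \<in> borel_measurable borel"
  by (intro borel_measurable_continuous_onI continuous_on_cheb)

definition arcsine_density :: "real \<Rightarrow> real" where
  "arcsine_density x = indicator {-2<..<2} x / (pi * sqrt (4 - x\<^sup>2))"

lemma arcsine_measure_eq: "arcsine_measure = density lborel (\<lambda>x. ennreal (arcsine_density x))"
  by (simp add: arcsine_measure_def arcsine_density_def)

lemma arcsine_density_measurable [measurable]: "arcsine_density \<in> borel_measurable borel"
  unfolding arcsine_density_def by measurable

lemma arcsine_density_nonneg: "0 \<le> arcsine_density x"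
proof (cases "x \<in> {-2<..<2}")
  case True
  then have "x\<^sup>2 \<le> 4" using abs_le_square_iff[of x 2] by auto
  then show ?thesis by (simp add: arcsine_density_def)
qed (simp add: arcsine_density_def)

text \<open>The function is the distribution function of the arcsine law minus 1: it runs from -1 at
  -2 to 0 at 2.\<close>

lemma arccos_half_deriv:
  assumes "x \<in> {-2<..<2}"
  shows "((\<lambda>x. - arccos (x / 2) / pi) has_real_derivative arcsine_density x) (at x)"
proof -
  have s: "sqrt (4 - x\<^sup>2) = 2 * sqrt (1 - (x / 2)\<^sup>2)"
    by (simp add: real_sqrt_mult[of 4, symmetric, simplified] power_divide algebra_simps)
  have "((\<lambda>x. arccos (x / 2)) has_real_derivative inverse (- sqrt (1 - (x / 2)\<^sup>2)) * (1 / 2)) (at x)"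
    using assms by (intro DERIV_chain2[OF DERIV_arccos]) (auto intro!: derivative_eq_intros)
  then have "((\<lambda>x. - arccos (x / 2) / pi) has_real_derivative - (inverse (- sqrt (1 - (x / 2)\<^sup>2)) * (1 / 2)) / pi) (at x)"
    by (intro DERIV_minus DERIV_cdivide)
  moreover have "- (inverse (- sqrt (1 - (x / 2)\<^sup>2)) * (1 / 2)) / pi = arcsine_density x"
    unfolding arcsine_density_def s using assms by (simp add: field_simps)
  ultimately show ?thesis by simp
qed

lemma has_integral_UNIV_cut:
  fixes f :: "real \<Rightarrow> real"
  assumes "(f has_integral I) {-2..2}" "\<And>x. x \<notin> {-2<..<2} \<Longrightarrow> f x = 0"
  shows "(f has_integral I) UNIV"
proof (rule has_integral_on_superset[OF assms(1)])
  show "f x = 0" if "x \<notin> {-2..2}" for x using that by (intro assms(2)) auto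
qed simp

lemma arcsine_density_has_integral: "(arcsine_density has_integral 1) UNIV"
proof -
  let ?G = "\<lambda>x. - arccos (x / 2) / pi"
  have "(arcsine_density has_integral (?G 2 - ?G (-2))) {-2..2}"
  proof (rule fundamental_theorem_of_calculus_interior)
    show "continuous_on {-2..2} ?G" by (intro continuous_intros) auto
    show "(?G has_vector_derivative arcsine_density x) (at x)" if "x \<in> {-2<..<2}" for x
      using arccos_half_deriv[OF that] by (simp only: has_real_derivative_iff_has_vector_derivative)
  qed simp
  then show ?thesis by (intro has_integral_UNIV_cut) (auto simp: arcsine_density_def)
qed

text \<open>With \<open>x = 2 cos \<theta>\<close> the law becomes uniform in
  \<open>\<theta>\<close> on \<open>[0, \<pi>]\<close> and \<open>cheb m x\<close> becomes
  \<open>2 cos(m \<theta>)\<close>, of mean 0. Carried out with an antiderivative, the singularities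
  of the density at the endpoints are harmless, since differentiability is required only in the
  interior.\<close>

lemma cheb_arcsine_has_integral:
  assumes "0 < m"
  shows "((\<lambda>x. arcsine_density x * cheb m x) has_integral 0) UNIV"
proof -
  define G where "G x = - arccos (x / 2) / pi" for x :: real
  define k where "k = real m * pi"
  have k: "0 < k" using assms by (simp add: k_def)
  \<comment> \<open>\<open>k * G x\<close> is \<open>- m \<theta>\<close> with
    \<open>\<theta> = arccos (x / 2)\<close>; at both endpoints it is a multiple of
    \<open>\<pi>\<close>, so \<open>?F\<close> vanishes there.\<close>
  let ?F = "\<lambda>x. (2 / k) * sin (k * G x)"
  have "((\<lambda>x. arcsine_density x * cheb m x) has_integral (?F 2 - ?F (-2))) {-2..2}"
  proof (rule fundamental_theorem_of_calculus_interior)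
    show "continuous_on {-2..2} ?F" unfolding G_def by (intro continuous_intros) auto
    fix x :: real assume x: "x \<in> {-2<..<2}"
    have "(G has_real_derivative arcsine_density x) (at x)"
      unfolding G_def[abs_def] by (rule arccos_half_deriv[OF x])
    then have "(?F has_real_derivative (2 / k) * (cos (k * G x) * (k * arcsine_density x))) (at x)"
      by (intro DERIV_cmult DERIV_fun_sin)
    moreover have "k * G x = - (m * arccos (x / 2))" by (simp add: k_def G_def)
    then have "cheb m x = 2 * cos (k * G x)"
      using cheb_cos[of m "arccos (x / 2)"] x by simp
    then have "(2 / k) * (cos (k * G x) * (k * arcsine_density x)) = arcsine_density x * cheb m x"
      using k by simp
    ultimately show "(?F has_vector_derivative arcsine_density x * cheb m x) (at x)"
      by (simp add: has_real_derivative_iff_has_vector_derivative)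
  qed simp
  moreover have "?F 2 - ?F (-2) = 0" by (simp add: G_def k_def)
  ultimately show ?thesis by (intro has_integral_UNIV_cut) (auto simp: arcsine_density_def)
qed

lemma arcsine_real_distribution: "real_distribution arcsine_measure"
proof -
  have "emeasure arcsine_measure (space arcsine_measure) = 1"
    using nn_integral_has_integral_lborel[OF arcsine_density_measurable arcsine_density_nonneg arcsine_density_has_integral]
    by (simp add: arcsine_measure_eq emeasure_density)
  then show ?thesis
    by (intro real_distribution.intro prob_spaceI real_distribution_axioms.intro)
       (auto simp: arcsine_measure_eq)
qed

lemma AE_arcsine: "AE x in arcsine_measure. \<bar>x\<bar> \<le> 2"
  unfolding arcsine_measure_eq
  by (subst AE_density) (auto simp: arcsine_density_def split: split_indicator)

lemma arcsine_density_integrable: "integrable lborel arcsine_density"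
  using nn_integral_has_integral_lborel[OF arcsine_density_measurable arcsine_density_nonneg arcsine_density_has_integral]
  by (intro integrableI_nonneg) (auto simp: arcsine_density_nonneg)

lemma integral_cheb_arcsine:
  assumes "0 < m"
  shows "(\<integral>x. cheb m x \<partial>arcsine_measure) = 0"
proof -
  have bound: "\<bar>cheb m x\<bar> \<le> 2" if "x \<in> {-2<..<2}" for x
    using cheb_cos[of m "arccos (x / 2)"] abs_cos_le_one[of "real m * arccos (x / 2)"] that
    by (simp add: abs_mult)
  have int: "integrable lborel (\<lambda>x. arcsine_density x * cheb m x)"
  proof (rule Bochner_Integration.integrable_bound)
    show "integrable lborel (\<lambda>x. 2 * arcsine_density x)" using arcsine_density_integrable by simp
    have "\<bar>arcsine_density x * cheb m x\<bar> \<le> 2 * arcsine_density x" for x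
    proof (cases "x \<in> {-2<..<2}")
      case True
      then show ?thesis
        using mult_left_mono[OF bound[OF True] arcsine_density_nonneg[of x]]
        by (simp add: abs_mult arcsine_density_nonneg mult.commute)
    qed (simp add: arcsine_density_def)
    then show "AE x in lborel. norm (arcsine_density x * cheb m x) \<le> norm (2 * arcsine_density x)"
      by (auto simp: arcsine_density_nonneg)
  qed measurable
  have "(\<integral>x. cheb m x \<partial>arcsine_measure) = (\<integral>x. arcsine_density x * cheb m x \<partial>lborel)"
    unfolding arcsine_measure_eq by (subst integral_density) (auto simp: arcsine_density_nonneg)
  also have "\<dots> = 0"
    using has_integral_integral_lborel[OF int] cheb_arcsine_has_integral[OF assms] has_integral_unique by blast
  finally show ?thesis .
qed

section \<open>Integrals and weak convergence on a common compact support\<close>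

lemma (in real_distribution) continuous_random_variable:
  fixes g :: "real \<Rightarrow> real"
  assumes "continuous_on UNIV g"
  shows "random_variable borel g"
  unfolding measurable_cong_sets[OF events_eq_borel refl] by (rule borel_measurable_continuous_onI[OF assms])

lemma (in real_distribution) integrable_continuous_bounded_support:
  fixes g :: "real \<Rightarrow> real"
  assumes "AE x in M. \<bar>x\<bar> \<le> K" "continuous_on UNIV g"
  shows "integrable M g"
proof -
  have "compact (g ` {-K..K})"
    using assms(2) by (intro compact_continuous_image) (auto intro: continuous_on_subset)
  then obtain B where B: "\<And>x. x \<in> {-K..K} \<Longrightarrow> norm (g x) \<le> B"
    by (meson bounded_iff compact_imp_bounded imageI)
  have "AE x in M. norm (g x) \<le> B" using assms(1) by eventually_elim (rule B, simp add: abs_le_iff)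
  then show ?thesis
    by (rule integrable_const_bound[of _ B]) (rule continuous_random_variable[OF assms(2)])
qed

lemma (in real_distribution) integral_diff_le:
  fixes f g :: "real \<Rightarrow> real"
  assumes "AE x in M. \<bar>x\<bar> \<le> K" "continuous_on UNIV f" "continuous_on UNIV g"
    and "\<And>x. \<bar>x\<bar> \<le> K \<Longrightarrow> \<bar>f x - g x\<bar> \<le> e"
  shows "\<bar>(\<integral>x. f x \<partial>M) - (\<integral>x. g x \<partial>M)\<bar> \<le> e"
proof -
  have int: "integrable M f" "integrable M g"
    using integrable_continuous_bounded_support assms(1-3) by blast+
  have "\<bar>(\<integral>x. f x \<partial>M) - (\<integral>x. g x \<partial>M)\<bar> = \<bar>\<integral>x. f x - g x \<partial>M\<bar>"
    using int by simp
  also have "\<dots> \<le> (\<integral>x. \<bar>f x - g x\<bar> \<partial>M)" by (rule integral_abs_bound)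
  also have "\<dots> \<le> (\<integral>x. e \<partial>M)"
  proof (rule integral_mono_AE)
    show "AE x in M. \<bar>f x - g x\<bar> \<le> e" using assms(1) by eventually_elim (auto intro: assms(4))
  qed (use int in auto)
  also have "\<dots> = e" using prob_space by simp
  finally show ?thesis .
qed

text \<open>Chebyshev polynomials span all polynomials because \<open>x \<cdot> cheb m = cheb (m + 1) + cheb (m - 1)\<close>,
  and polynomials are uniformly dense on the common compact support.\<close>

lemma weak_conv_from_cheb_moments:
  assumes N: "\<And>n. real_distribution (N n)" and M: "real_distribution M"
    and suppN: "\<And>n. AE x in N n. \<bar>x\<bar> \<le> K" and suppM: "AE x in M. \<bar>x\<bar> \<le> K"
    and moments: "\<And>m. (\<lambda>n. \<integral>x. cheb m x \<partial>N n) \<longlonglongrightarrow> (\<integral>x. cheb m x \<partial>M)"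
  shows "weak_conv_m N M"
proof -
  interpret M: real_distribution M by fact
  interpret N: real_distribution "N n" for n by fact
  have int: "integrable (N n) g" "integrable M g" if "continuous_on UNIV g" for g :: "real \<Rightarrow> real" and n
    using N.integrable_continuous_bounded_support[OF suppN that] M.integrable_continuous_bounded_support[OF suppM that] by auto
  have cont: "continuous_on UNIV (\<lambda>x. x ^ j * cheb m x)" for j m
    by (intro continuous_intros continuous_on_cheb)
  \<comment> \<open>Mixed products make the induction on \<open>j\<close> work: one factor
    \<open>x\<close> is traded for a change of \<open>m\<close>, so the claim is needed for all
    \<open>m\<close> at once.\<close>
  have pow: "(\<lambda>n. \<integral>x. x ^ j * cheb m x \<partial>N n) \<longlonglongrightarrow> (\<integral>x. x ^ j * cheb m x \<partial>M)" for j m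
  proof (induction j arbitrary: m)
    case 0
    then show ?case using moments by simp
  next
    case (Suc j)
    show ?case
    proof (cases m)
      case 0
      \<comment> \<open>There is no index \<open>m - 1\<close> here;
        \<open>x * cheb 0 x = 2 * cheb 1 x\<close> replaces the general relation.\<close>
      have eq: "(\<lambda>x. x ^ Suc j * cheb m x) = (\<lambda>x. 2 * (x ^ j * cheb 1 x))" by (simp add: 0 fun_eq_iff)
      show ?thesis unfolding eq integral_mult_right_zero by (intro tendsto_intros Suc)
    next
      case (Suc k)
      have eq: "(\<lambda>x. x ^ Suc j * cheb m x) = (\<lambda>x. x ^ j * cheb (Suc m) x + x ^ j * cheb k x)"
        by (simp add: Suc fun_eq_iff algebra_simps)
      show ?thesis
        unfolding eq Bochner_Integration.integral_add[OF int(1)[OF cont] int(1)[OF cont]]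
          Bochner_Integration.integral_add[OF int(2)[OF cont] int(2)[OF cont]]
        by (intro tendsto_add Suc.IH)
    qed
  qed
  have poly: "(\<lambda>n. \<integral>x. (\<Sum>i\<le>d. a i * x ^ i) \<partial>N n) \<longlonglongrightarrow> (\<integral>x. (\<Sum>i\<le>d. a i * x ^ i) \<partial>M)" for a d
  proof -
    have c: "continuous_on UNIV (\<lambda>x. a i * x ^ i)" for i by (intro continuous_intros)
    have "(\<lambda>n. \<integral>x. a i * x ^ i \<partial>N n) \<longlonglongrightarrow> (\<integral>x. a i * x ^ i \<partial>M)" for i
    proof -
      have eq: "(\<lambda>x. a i * x ^ i) = (\<lambda>x. a i / 2 * (x ^ i * cheb 0 x))" by (simp add: fun_eq_iff)
      show ?thesis unfolding eq integral_mult_right_zero by (intro tendsto_intros pow)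
    qed
    then have "(\<lambda>n. \<Sum>i\<le>d. \<integral>x. a i * x ^ i \<partial>N n) \<longlonglongrightarrow> (\<Sum>i\<le>d. \<integral>x. a i * x ^ i \<partial>M)"
      by (intro tendsto_sum)
    then show ?thesis using int[OF c] by (simp add: Bochner_Integration.integral_sum)
  qed
  show ?thesis
  proof (rule integral_bdd_continuous_conv_imp_weak_conv[OF N M])
    fix f :: "real \<Rightarrow> real" assume "\<And>x. isCont f x" "\<And>x. \<bar>f x\<bar> \<le> 1"
    then have f: "continuous_on UNIV f" by (simp add: continuous_at_imp_continuous_on)
    show "(\<lambda>n. \<integral>x. f x \<partial>N n) \<longlonglongrightarrow> (\<integral>x. f x \<partial>M)"
    proof (rule LIMSEQ_I)
      fix e :: real assume e: "0 < e"
      obtain g where g: "real_polynomial_function g" "\<And>x. x \<in> {-K..K} \<Longrightarrow> \<bar>f x - g x\<bar> < e / 3"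
        using Stone_Weierstrass_real_polynomial_function[of "{-K..K}" f "e / 3"] f e
        by (metis compact_Icc continuous_on_subset divide_pos_pos subset_UNIV zero_less_numeral)
      obtain a d where gd: "g = (\<lambda>x. \<Sum>i\<le>d. a i * x ^ i)"
        using g(1) unfolding real_polynomial_function_iff_sum by blast
      have cg: "continuous_on UNIV g" unfolding gd by (intro continuous_intros)
      have close: "\<bar>f x - g x\<bar> \<le> e / 3" if "\<bar>x\<bar> \<le> K" for x
        using g(2)[of x] that by (simp add: abs_le_iff)
      obtain n0 where n0: "\<And>n. n \<ge> n0 \<Longrightarrow> \<bar>(\<integral>x. g x \<partial>N n) - (\<integral>x. g x \<partial>M)\<bar> < e / 3"
        using LIMSEQ_D[OF poly[of a d, folded gd], of "e / 3"] e by auto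
      have "norm ((\<integral>x. f x \<partial>N n) - (\<integral>x. f x \<partial>M)) < e" if "n \<ge> n0" for n
        using N.integral_diff_le[OF suppN f cg close, of n] M.integral_diff_le[OF suppM f cg close] n0[OF that]
        unfolding real_norm_def by linarith
      then show "\<exists>n0. \<forall>n\<ge>n0. norm ((\<integral>x. f x \<partial>N n) - (\<integral>x. f x \<partial>M)) < e" by blast
    qed
  qed
qed

text \<open>A continuous \<open>g\<close> may be unbounded, and weak convergence tests only bounded
  functions. Clamping the argument to \<open>[-K, K]\<close> makes \<open>g\<close> bounded without
  changing its integrals against \<open>N n\<close>; as nothing is assumed about the support of
  \<open>M\<close>, the clamp remains in the limit.\<close>

lemma weak_conv_imp_integral_conv:
  fixes g :: "real \<Rightarrow> real"
  assumes N: "\<And>n. real_distribution (N n)" and M: "real_distribution M"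
    and suppN: "\<And>n. AE x in N n. \<bar>x\<bar> \<le> K" and g: "continuous_on UNIV g" and w: "weak_conv_m N M"
  shows "(\<lambda>n. \<integral>x. g x \<partial>N n) \<longlonglongrightarrow> (\<integral>x. g (max (- K) (min K x)) \<partial>M)"
proof (cases "0 \<le> K")
  case True
  let ?g = "\<lambda>x. g (max (- K) (min K x))"
  interpret N: real_distribution "N n" for n by fact
  have cg: "continuous_on UNIV ?g"
    by (intro continuous_on_compose2[OF g] continuous_intros) auto
  have "compact (g ` {-K..K})"
    using g by (intro compact_continuous_image) (auto intro: continuous_on_subset)
  then obtain B where B: "\<And>x. x \<in> {-K..K} \<Longrightarrow> norm (g x) \<le> B"
    by (meson bounded_iff compact_imp_bounded imageI)
  have "(\<lambda>n. \<integral>x. ?g x \<partial>N n) \<longlonglongrightarrow> (\<integral>x. ?g x \<partial>M)"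
  proof (rule weak_conv_imp_integral_bdd_continuous_conv[OF N M w])
    show "isCont ?g x" for x using cg by (simp add: continuous_on_eq_continuous_at)
    show "norm (?g x) \<le> B" for x by (rule B) (use True in auto)
  qed
  moreover have "(\<integral>x. ?g x \<partial>N n) = (\<integral>x. g x \<partial>N n)" for n
  proof (rule integral_cong_AE)
    show "AE x in N n. ?g x = g x" using suppN[of n] by eventually_elim (auto simp: abs_le_iff min_def max_def)
  qed (intro N.continuous_random_variable cg g)+
  ultimately show ?thesis by simp
next
  case False
  interpret real_distribution "N 0" by fact
  have "AE x in N 0. False" using suppN[of 0] by eventually_elim (use False in linarith)
  then show ?thesis by simp
qed

section \<open>Averages over eigenvalue multisets\<close>

lemma sum_count_mset:
  fixes g :: "'b \<Rightarrow> real"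
  assumes "finite S" "set es \<subseteq> S"
  shows "(\<Sum>a\<in>S. g a * real (count (mset es) a)) = (\<Sum>e\<leftarrow>es. g e)"
  using assms(2)
proof (induction es)
  case (Cons e es)
  have "(\<Sum>a\<in>S. g a * real (count (mset (e # es)) a))
      = (\<Sum>a\<in>S. (if a = e then g e else 0) + g a * real (count (mset es) a))"
    by (intro sum.cong) (auto simp: algebra_simps)
  then show ?case using Cons assms(1) by (simp add: sum.distrib)
qed simp

lemma expectation_pmf_of_mset:
  fixes g :: "real \<Rightarrow> real"
  assumes "es \<noteq> []"
  shows "(\<integral>x. g x \<partial>measure_pmf (pmf_of_multiset (mset es))) = (\<Sum>e\<leftarrow>es. g e) / length es"
proof -
  have ne: "mset es \<noteq> {#}" using assms by simp
  have "(\<integral>x. g x \<partial>measure_pmf (pmf_of_multiset (mset es)))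
      = (\<Sum>a\<in>set es. g a * pmf (pmf_of_multiset (mset es)) a)"
    by (rule integral_measure_pmf_real) (auto simp only: set_pmf_of_multiset[OF ne] set_mset_mset finite_set)
  also have "\<dots> = (\<Sum>a\<in>set es. g a * real (count (mset es) a)) / length es"
    by (simp only: pmf_of_multiset[OF ne] size_mset sum_divide_distrib times_divide_eq_right)
  also have "(\<Sum>a\<in>set es. g a * real (count (mset es) a)) = (\<Sum>e\<leftarrow>es. g e)"
    by (rule sum_count_mset) auto
  finally show ?thesis .
qed

lemma proots_prod_linear: "proots (\<Prod>e\<leftarrow>es. [:- e, 1:]) = mset (es :: real list)"
proof (induction es)
  case (Cons e es)
  have "(\<Prod>e\<leftarrow>es. [:- e, 1:]) \<noteq> (0 :: real poly)" by (auto simp: prod_list_zero_iff)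
  then show ?case using Cons by (simp add: proots_mult del: mult_pCons_left)
qed simp

section \<open>Spectral measures of Rauzy graphs\<close>

lemma sum_nth_distinct:
  fixes f :: "'b \<Rightarrow> real"
  assumes "distinct vs"
  shows "(\<Sum>i<length vs. f (vs ! i)) = (\<Sum>v\<in>set vs. f v)"
  by (rule sum.reindex_bij_betw[OF bij_betw_nth[OF assms refl refl]])

context almost_prolongable_language
begin

lemma rauzy_enum: "distinct (rauzy_enum L n)" "set (rauzy_enum L n) = lang_n L n"
proof -
  have "\<exists>vs. distinct vs \<and> set vs = rauzy_verts L n"
    using finite_distinct_list[OF finite_lang_n[of L n]] by (auto simp: rauzy_verts_def)
  from someI_ex[OF this] show "distinct (rauzy_enum L n)" "set (rauzy_enum L n) = lang_n L n"
    by (auto simp: rauzy_enum_def rauzy_verts_def)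
qed

lemma length_rauzy_enum: "length (rauzy_enum L n) = complexity L n"
  using distinct_card[OF rauzy_enum(1)[of n]] rauzy_enum(2)[of n] by (simp add: complexity_def)

lemma rauzy_adj_matrix_carrier: "rauzy_adj_matrix L n \<in> carrier_mat (complexity L n) (complexity L n)"
  by (simp add: rauzy_adj_matrix_def Let_def length_rauzy_enum)

lemma rauzy_adj_matrix_index:
  assumes "i < complexity L n" "j < complexity L n"
  shows "rauzy_adj_matrix L n $$ (i, j) = real (rauzy_adj L n (rauzy_enum L n ! i) (rauzy_enum L n ! j))"
  using assms by (simp add: rauzy_adj_matrix_def Let_def length_rauzy_enum)

lemma sum_rauzy_enum: "(\<Sum>i<complexity L n. f (rauzy_enum L n ! i)) = (\<Sum>v\<in>lang_n L n. f v :: real)"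
  using sum_nth_distinct[OF rauzy_enum(1), of f n] by (simp add: length_rauzy_enum rauzy_enum(2))

lemma rauzy_enum_in: "i < complexity L n \<Longrightarrow> rauzy_enum L n ! i \<in> lang_n L n"
  using nth_mem[of i "rauzy_enum L n"] by (simp add: length_rauzy_enum rauzy_enum(2))

text \<open>The inner sum of the matrix product becomes the sum over words in
  \<open>cheb_entry\<close>; distinctness of the enumeration matches the identity matrix with
  \<open>of_bool (u = v)\<close>.\<close>

lemma cheb_mat_rauzy:
  assumes "i < complexity L n" "j < complexity L n"
  shows "cheb_mat m (rauzy_adj_matrix L n) $$ (i, j) = cheb_entry L n m (rauzy_enum L n ! i) (rauzy_enum L n ! j)"
  using assms
proof (induction m arbitrary: i j rule: less_induct)
  case (less m)
  let ?A = "rauzy_adj_matrix L n" and ?vs = "rauzy_enum L n" and ?p = "complexity L n"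
  note A = rauzy_adj_matrix_carrier[of n]
  consider "m = 0" | "m = Suc 0" | k where "m = Suc (Suc k)" by (metis not0_implies_Suc)
  then show ?case
  proof cases
    case 1
    have "?vs ! i = ?vs ! j \<longleftrightarrow> i = j"
      using nth_eq_iff_index_eq[OF rauzy_enum(1)[of n]] less.prems by (simp add: length_rauzy_enum)
    then show ?thesis using 1 A less.prems by simp
  next
    case 2
    then show ?thesis using rauzy_adj_matrix_index less.prems by simp
  next
    case 3
    define X where "X = cheb_mat (Suc k) ?A"
    define Y where "Y = cheb_mat k ?A"
    have c: "X \<in> carrier_mat ?p ?p" "Y \<in> carrier_mat ?p ?p" using A by (auto simp: X_def Y_def)
    have "(?A * X) $$ (i, j) = (\<Sum>l<?p. ?A $$ (i, l) * X $$ (l, j))"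
      using A c less.prems by (auto simp: scalar_prod_def atLeast0LessThan intro!: sum.cong)
    also have "\<dots> = (\<Sum>l<?p. real (rauzy_adj L n (?vs ! i) (?vs ! l)) * cheb_entry L n (Suc k) (?vs ! l) (?vs ! j))"
      using less.IH[of "Suc k"] less.prems 3 by (intro sum.cong) (auto simp: rauzy_adj_matrix_index X_def)
    also have "\<dots> = (\<Sum>x\<in>lang_n L n. real (rauzy_adj L n (?vs ! i) x) * cheb_entry L n (Suc k) x (?vs ! j))"
      by (rule sum_rauzy_enum)
    finally have "(?A * X) $$ (i, j) = \<dots>" .
    moreover have "Y $$ (i, j) = cheb_entry L n k (?vs ! i) (?vs ! j)"
      unfolding Y_def by (rule less.IH) (use less.prems 3 in auto)
    moreover have "(?A * X - Y) $$ (i, j) = (?A * X) $$ (i, j) - Y $$ (i, j)"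
      using A c less.prems by (intro index_minus_mat) auto
    ultimately have "(?A * X - Y) $$ (i, j) = cheb_entry L n m (?vs ! i) (?vs ! j)"
      by (simp only: 3 cheb_entry.simps)
    then show ?thesis by (simp add: 3 X_def Y_def)
  qed
qed

text \<open>Here the enumeration chosen by \<open>SOME\<close> disappears: the later arguments see
  only an eigenvalue list whose bound is uniform in \<open>n\<close> and whose Chebyshev sums are
  sums of local quantities.\<close>

lemma rauzy_spectrum:
  obtains es where "length es = complexity L n"
    "spectral_measure L n = measure_pmf (pmf_of_multiset (mset es))"
    "\<And>e. e \<in> set es \<Longrightarrow> \<bar>e\<bar> \<le> 2 * real CARD('a)"
    "\<And>m. (\<Sum>e\<leftarrow>es. cheb m e) = (\<Sum>v\<in>lang_n L n. cheb_entry L n m v v)"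
proof -
  let ?A = "rauzy_adj_matrix L n" and ?p = "complexity L n"
  note A = rauzy_adj_matrix_carrier[of n]
  obtain es where es: "char_poly ?A = (\<Prod>e\<leftarrow>es. [:- e, 1:])" "length es = ?p"
  proof (rule symmetric_char_poly_splits[OF A])
    show "?A $$ (i, j) = ?A $$ (j, i)" if "i < ?p" "j < ?p" for i j
      using that by (simp add: rauzy_adj_matrix_index rauzy_adj_sym[of L n "rauzy_enum L n ! i"])
  qed
  have "\<bar>e\<bar> \<le> 2 * real CARD('a)" if "e \<in> set es" for e
  proof (rule eigenvalue_row_sum_bound[OF A])
    show "eigenvalue ?A e"
      using that unfolding eigenvalue_root_char_poly[OF A] es(1) by (induction es) auto
    fix i assume i: "i < ?p"
    have "(\<Sum>j<?p. \<bar>?A $$ (i, j)\<bar>) = (\<Sum>j<?p. real (rauzy_adj L n (rauzy_enum L n ! i) (rauzy_enum L n ! j)))"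
      using i by (intro sum.cong) (auto simp: rauzy_adj_matrix_index)
    also have "\<dots> = (\<Sum>x\<in>lang_n L n. real (rauzy_adj L n (rauzy_enum L n ! i) x))"
      by (rule sum_rauzy_enum)
    also have "\<dots> \<le> 2 * real CARD('a)"
      by (rule rauzy_adj_row_sum_le[OF rauzy_enum_in[OF i]])
    finally show "(\<Sum>j<?p. \<bar>?A $$ (i, j)\<bar>) \<le> 2 * real CARD('a)" .
  qed
  moreover have "(\<Sum>e\<leftarrow>es. cheb m e) = (\<Sum>v\<in>lang_n L n. cheb_entry L n m v v)" for m
  proof -
    have "(\<Sum>e\<leftarrow>es. cheb m e) = mat_trace (cheb_mat m ?A)"
      by (rule mat_trace_cheb_mat[OF A es(1), symmetric])
    also have "\<dots> = (\<Sum>i<?p. cheb_entry L n m (rauzy_enum L n ! i) (rauzy_enum L n ! i))"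
      using cheb_mat_carrier[OF A, of m] by (auto simp: mat_trace_def cheb_mat_rauzy intro!: sum.cong)
    also have "\<dots> = (\<Sum>v\<in>lang_n L n. cheb_entry L n m v v)"
      by (rule sum_rauzy_enum)
    finally show ?thesis .
  qed
  moreover have "spectral_measure L n = measure_pmf (pmf_of_multiset (mset es))"
    by (simp add: spectral_measure_def es(1) proots_prod_linear)
  ultimately show ?thesis using that es(2) by blast
qed

text \<open>The measurable sets of \<open>measure_pmf\<close> are all sets, so the spectral measure is not literally a
  \<open>real_distribution\<close>; only its cdf matters for weak convergence.\<close>

definition spectral_distr :: "nat \<Rightarrow> real measure" where
  "spectral_distr n = distr (spectral_measure L n) borel (\<lambda>x. x)"

lemma spectral_distr_real_distribution: "real_distribution (spectral_distr n)"
  unfolding spectral_distr_def spectral_measure_def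
  by (rule prob_space.real_distribution_distr[OF prob_space_measure_pmf]) simp

lemma weak_conv_spectral_distr: "weak_conv_m (spectral_measure L) M \<longleftrightarrow> weak_conv_m spectral_distr M"
proof -
  have "cdf (spectral_distr n) = cdf (spectral_measure L n)" for n
    unfolding spectral_distr_def spectral_measure_def
    by (rule ext) (simp add: cdf_def measure_distr)
  then show ?thesis by (simp add: weak_conv_m_def)
qed

lemma spectral_distr_support: "AE x in spectral_distr n. \<bar>x\<bar> \<le> 2 * real CARD('a)"
proof -
  obtain es where es: "length es = complexity L n"
    "spectral_measure L n = measure_pmf (pmf_of_multiset (mset es))"
    "\<And>e. e \<in> set es \<Longrightarrow> \<bar>e\<bar> \<le> 2 * real CARD('a)"
    by (rule rauzy_spectrum) blast
  have ne: "mset es \<noteq> {#}" using es(1) complexity_pos[of n] by auto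
  show ?thesis
    unfolding spectral_distr_def es(2)
    by (subst AE_distr_iff) (auto simp: AE_measure_pmf_iff set_pmf_of_multiset[OF ne] es(3))
qed

lemma integral_cheb_spectral:
  "(\<integral>x. cheb m x \<partial>spectral_distr n) = (\<Sum>v\<in>lang_n L n. cheb_entry L n m v v) / complexity L n"
proof -
  obtain es where es: "length es = complexity L n"
    "spectral_measure L n = measure_pmf (pmf_of_multiset (mset es))"
    "\<And>m. (\<Sum>e\<leftarrow>es. cheb m e) = (\<Sum>v\<in>lang_n L n. cheb_entry L n m v v)"
    by (rule rauzy_spectrum) blast
  have ne: "es \<noteq> []" using es(1) complexity_pos[of n] by auto
  have "(\<integral>x. cheb m x \<partial>spectral_distr n) = (\<integral>x. cheb m x \<partial>measure_pmf (pmf_of_multiset (mset es)))"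
    unfolding spectral_distr_def es(2) by (rule integral_distr) simp_all
  then show ?thesis by (simp add: expectation_pmf_of_mset[OF ne] es)
qed

lemma ratio_imp_arcsine:
  assumes "ratio \<longlonglongrightarrow> 1"
  shows "weak_conv_m (spectral_measure L) arcsine_measure"
  unfolding weak_conv_spectral_distr
proof (rule weak_conv_from_cheb_moments[OF spectral_distr_real_distribution arcsine_real_distribution spectral_distr_support])
  have "1 \<le> real CARD('a)" by (simp add: Suc_le_eq)
  then show "AE x in arcsine_measure. \<bar>x\<bar> \<le> 2 * real CARD('a)"
    by (intro eventually_mono[OF AE_arcsine]) linarith
  fix m
  show "(\<lambda>n. \<integral>x. cheb m x \<partial>spectral_distr n) \<longlonglongrightarrow> (\<integral>x. cheb m x \<partial>arcsine_measure)"
  proof (cases "m = 0")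
    case True
    have "prob_space (spectral_distr n)" "prob_space arcsine_measure" for n
      using spectral_distr_real_distribution arcsine_real_distribution real_distribution_def by auto
    then show ?thesis using True by (simp add: prob_space.prob_space)
  next
    case False
    then show ?thesis
      using cheb_trace_tendsto_0[OF assms] by (simp add: integral_cheb_spectral integral_cheb_arcsine)
  qed
qed

text \<open>Up to a vanishing error the ratio is an affine function of the second Chebyshev moment.
  For an unidentified \<open>M\<close> the point is that a limit exists; subexponential growth then
  fixes its value.\<close>

lemma weak_conv_imp_ratio:
  assumes "weak_conv_m (spectral_measure L) M" "real_distribution M"
  shows "ratio \<longlonglongrightarrow> 1 + (\<integral>x. cheb 2 (max (- (2 * real CARD('a))) (min (2 * real CARD('a)) x)) \<partial>M) / 2"
proof (rule cheb_trace_2_convergent_imp)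
  have "weak_conv_m spectral_distr M" using assms(1) by (simp add: weak_conv_spectral_distr)
  from weak_conv_imp_integral_conv[OF spectral_distr_real_distribution assms(2) spectral_distr_support continuous_on_cheb this]
  show "(\<lambda>n. (\<Sum>v\<in>lang_n L n. cheb_entry L n 2 v v) / complexity L n)
      \<longlonglongrightarrow> (\<integral>x. cheb 2 (max (- (2 * real CARD('a))) (min (2 * real CARD('a)) x)) \<partial>M)"
    by (simp add: integral_cheb_spectral)
qed

text \<open>The arcsine law lives on \<open>[-2, 2]\<close>, where clamping at
  \<open>2 CARD('a)\<close> does nothing, and its second Chebyshev moment is 0, so the limit law
  itself yields the value 1.\<close>

lemma arcsine_imp_ratio:
  assumes "weak_conv_m (spectral_measure L) arcsine_measure"
  shows "ratio \<longlonglongrightarrow> 1"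
proof -
  interpret real_distribution arcsine_measure by (rule arcsine_real_distribution)
  have k: "1 \<le> real CARD('a)" by (simp add: Suc_le_eq)
  have "(\<integral>x. cheb 2 (max (- (2 * real CARD('a))) (min (2 * real CARD('a)) x)) \<partial>arcsine_measure)
      = (\<integral>x. cheb 2 x \<partial>arcsine_measure)"
  proof (rule integral_cong_AE)
    show "AE x in arcsine_measure. cheb 2 (max (- (2 * real CARD('a))) (min (2 * real CARD('a)) x)) = cheb 2 x"
      using AE_arcsine
    proof eventually_elim
      case (elim x)
      have "1 \<le> a \<Longrightarrow> max (- (2 * a)) (min (2 * a) x) = x" for a using elim by (auto simp: min_def max_def)
      from this[OF k] show ?case by simp
    qed
  qed measurable
  then show ?thesis
    using weak_conv_imp_ratio[OF assms arcsine_real_distribution] by (simp add: integral_cheb_arcsine)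
qed

end

theorem theorem1p1:
  fixes L :: "('a :: finite) list set"
  assumes "CARD('a) \<ge> 2"
    and "factorial_lang L"
    and "almost_prolongable L"
    and "\<not> bdd_above (range (complexity L))"
  shows
    "(subexponential (complexity L) \<and> BS_limit_exists False L
        \<longleftrightarrow> BS_converges_to_line False L)
   \<and> (BS_converges_to_line False L
        \<longleftrightarrow> subexponential (complexity L) \<and>
            (\<exists>M. real_distribution M \<and> weak_conv_m (spectral_measure L) M))
   \<and> (subexponential (complexity L) \<and>
            (\<exists>M. real_distribution M \<and> weak_conv_m (spectral_measure L) M)
        \<longleftrightarrow> weak_conv_m (spectral_measure L) arcsine_measure)
   \<and> (weak_conv_m (spectral_measure L) arcsine_measure
        \<longleftrightarrow> (\<lambda>n. real (complexity L (n + 1)) / real (complexity L n)) \<longlonglongrightarrow> 1)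
   \<and> ((\<lambda>n. real (complexity L (n + 1)) / real (complexity L n)) \<longlonglongrightarrow> 1
        \<longleftrightarrow> subexponential (complexity L) \<and> BS_limit_exists True L)
   \<and> (subexponential (complexity L) \<and> BS_limit_exists True L
        \<longleftrightarrow> BS_converges_to_line True L)"
proof -
  interpret almost_prolongable_language L
    by standard (use assms in auto)
  have line: "BS_converges_to_line d L \<longleftrightarrow> ratio \<longlonglongrightarrow> 1" for d
  proof
    show "BS_converges_to_line d L" if "ratio \<longlonglongrightarrow> 1"
      using ratio_imp_directed_line[OF that] directed_line_imp_undirected_line by (cases d) auto
  qed (rule line_imp_ratio)
  \<comment> \<open>From left to right, growth singles out the value 1 among the possible limits of
    the ratio; from right to left, the limit is obtained through convergence to the line.\<close>
  have BS: "subexponential (complexity L) \<and> BS_limit_exists d L \<longleftrightarrow> ratio \<longlonglongrightarrow> 1" for d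
    using BS_limit_imp_convergent_ratio[of d] convergent_ratio_imp_1 ratio_1_imp_subexponential
      line_imp_BS_limit[of d] line[of d] by blast
  have arcsine: "weak_conv_m (spectral_measure L) arcsine_measure \<longleftrightarrow> ratio \<longlonglongrightarrow> 1"
    using ratio_imp_arcsine arcsine_imp_ratio by blast
  have spectral: "subexponential (complexity L) \<and> (\<exists>M. real_distribution M \<and> weak_conv_m (spectral_measure L) M)
      \<longleftrightarrow> ratio \<longlonglongrightarrow> 1"
    using weak_conv_imp_ratio convergentI convergent_ratio_imp_1 ratio_1_imp_subexponential
      ratio_imp_arcsine arcsine_real_distribution by blast
  show ?thesis unfolding line BS arcsine spectral by simp
qed

end
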